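(* Let $P$ be a valid FD-AST problem, let $h\in\mathbb{N}$, and let $\Pi=\varphi(\mathrm{FDR}(P))$ be the STRIPS problem obtained by compiling $P$ first to FDR and then to STRIPS. Then, for all choices of the arbitrary orderings and arbitrary elements involved in the encoding and decoding functions: (i) if the list of non-zero integers $[n_1,n_2,\dots]$ is a model for the DIMACS-CNF AST $\mathrm{simp}(\Phi(\Pi,h))$, then $[\mathrm{AST}(\varphi_O^{-1}(op_1)),\mathrm{AST}(\varphi_O^{-1}(op_2)),\dots]$ is a plan (solution) for $P$, where $[op_1,op_2,\dots]=\Phi^{-1}(\Pi,h,\{\mathrm{lit}(n_1),\mathrm{lit}(n_2),\dots\})$; and (ii) if $[name_1,\dots,name_h]$ is a plan (solution) for $P$, then there is a model for the DIMACS-CNF AST $\mathrm{simp}(\Phi(\Pi,h))$.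
   Context: Mappings. A mapping is a (finite) set of maplets $v\mapsto a$ that is single-valued; $\mathcal{D}(f)$ is the set of $v$ with some $v\mapsto a\in f$. Inclusion of mappings is inclusion of sets of maplets. $\mathrm{ch}(s)$ is an arbitrary element of a non-empty set $s$. FD-AST. An FD-AST problem is a tuple $P=(V,I,G,O)$ where $V,I,G$ are finite mappings from $\mathbb{N}$ to $\mathbb{N}$ ($V(v)$ is the number of values variable $v$ can take) and $O$ is a finite set of operators. An operator is a triple $(name,ps,es)$ with $name$ a string, $ps$ a mapping from $\mathbb{N}$ to $\mathbb{N}$ (prevail preconditions), and $es$ a finite set of effects; an effect is a tuple $(epre,v,l,m)$ with $epre$ a mapping from $\mathbb{N}$ to $\mathbb{N}$ and $v,l,m\in\mathbb{N}$. A partial state $s$ is well-formed iff $\mathcal{D}(s)\subseteq\mathcal{D}(V)$ and $s(v)<V(v)$ for all $v\in\mathcal{D}(s)$; a well-formed state is a well-formed partial state with $\mathcal{D}(s)=\mathcal{D}(V)$. An operator is well-formed iff $ps$ is a well-formed partial state, any two distinct effects in $es$ have distinct variables $v$, and for each $(epre,v,l,m)\in es$, $v\in\mathcal{D}(V)$, $epre$ is a well-formed partial state and $l,m<V(v)$. $P$ is well-formed iff $I$ is a well-formed state, $G$ is a well-formed partial state, operators have pairwise distinct names, and all operators are well-formed. $P$ is valid iff it is well-formed, every effect of every operator has $epre=\emptyset$, and for every operator $(name,ps,es)\in O$ and every $(epre,v,l,m)\in es$ with $v\in\mathcal{D}(ps)$ we have $ps(v)=l$. FD-AST execution. $(name,ps,es)$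 is executable in a state $s$ iff $ps\subseteq s$ and $v\mapsto l\in s$ for each $(epre,v,l,m)\in es$. The resulting state is $(s\setminus\{v\mapsto l\mid (epre,v,l,m)\in es, epre\subseteq s\})\cup\{v\mapsto m\mid (epre,v,l,m)\in es, epre\subseteq s\}$. A plan (solution) for $P$ is a list of names $[name_1,\dots,name_n]$, each the name of an operator in $O$, such that the operators with these names are executable in order starting at $I$ and $G$ is a subset of the final state. FDR. An FDR problem is a tuple $(V,\mathcal{R},I,O,G)$ with $V$ a finite set of variables, $\mathcal{R}$ assigning to each $v\in V$ a finite set of values, $I$ a state (a mapping defined on all of $V$), $G$ a partial state, and $O$ a finite set of operators $(p,e)$, where $p$ (precondition) and $e$ (effect) are partial states. It is a STRIPS problem if $\mathcal{R}(v)=\{\bot,\top\}$ for all $v\in V$; then $v$ abbreviates the maplet $v\mapsto\top$ and $\overline{v}$ abbreviates $v\mapsto\bot$. Encoding FD-AST to FDR. For $P=(V,I,G,O)$, and an operator $o=(name,ps,es)$, let $\mathrm{FDR}_O(o)=(ps\cup\{v\mapsto l\mid(epre,v,l,m)\in es\},\ \{v\mapsto m\mid(epre,v,l,m)\in es\})$. Then $\mathrm{FDR}(P)$ is the FDR problem with variables $\mathcal{D}(V)$, ranges $v\mapsto\{0,\dots,V(v)-1\}$, initial state $I$, operators $\{\mathrm{FDR}_O(o)\mid o\in O\}$, and goal $G$. For an FDR operator $op$, $\mathrm{AST}(op)=\mathrm{ch}\{name\mid (name,ps,es)\in O,\ \mathrm{FDR}_O(name,ps,es)=op\}$. Encoding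 FDR to STRIPS. For an FDR problem $\Psi=(V,\mathcal{R},I,O,G)$ and a partial state $s$ let $\varphi_S(s)=\{(v,a)\mid v\in\mathcal{D}(s), s(v)=a\}\cup\{\overline{(v,a)}\mid v\in\mathcal{D}(s)\cap V, a\in\mathcal{R}(v), s(v)\neq a\}$. $\varphi(\Psi)$ is the STRIPS problem with variables $\{(v,a)\mid v\in V,a\in\mathcal{R}(v)\}$, initial state $\varphi_S(I)$, goal $\varphi_S(G)$, and operators $\{(\varphi_S(p),\varphi_S(e))\mid(p,e)\in O\}$. For an operator $(p,e)$ of $\varphi(\Psi)$, $\varphi_O^{-1}(p,e)=(\{v\mapsto a\mid (v,a)\mapsto\top\in p\},\{v\mapsto a\mid (v,a)\mapsto\top\in e\})$. SAT encoding. Let $\Pi=(V,R,I,O,G)$ be a STRIPS problem. Two distinct operators $(p_1,e_1),(p_2,e_2)$ are interfering iff for some $i\neq j$ in $\{1,2\}$, $\{v\mid v\mapsto\top\in p_i\}\cap\{v\mid v\mapsto\bot\in e_j\}\neq\emptyset$; $\mathrm{intrfr}(O)$ is the set of interfering pairs. The atoms are $v^t$ ($v\in V$, $0\le t\le h$) and $op^t$ ($op\in O$, $0\le t<h$). For a partial state $s$, $s^t$ denotes $\bigwedge_{v\mapsto\top\in s}v^t\wedge\bigwedge_{v\mapsto\bot\in s}\neg v^t$. Let $\mathrm{add}(v)=\{(p,e)\in O\mid v\mapsto\top\in e\}$ and $\mathrm{del}(v)=\{(p,e)\in O\mid v\mapsto\bot\in e\}$. $\Phi(\Pi,h)$ is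 the conjunction of: $I^0$; $G^h$; for all $0\le t<h$ and $op=(p,e)\in O$, $(op^t\to p^t)\wedge(op^t\to e^{t+1})$; for all $1\le t\le h$ and $v\in V$, $\neg v^{t-1}\wedge v^t\to\bigvee_{op\in\mathrm{add}(v)}op^{t-1}$; for all $1\le t\le h$ and $v\in V$, $v^{t-1}\wedge\neg v^t\to\bigvee_{op\in\mathrm{del}(v)}op^{t-1}$; for all $0\le t<h$ and $(op,op')\in\mathrm{intrfr}(O)$, $\neg op^t\vee\neg op'^t$. It is written in CNF: $x_1\wedge x_2\to\bigvee_i y_i$ stands for $\neg x_1\vee\neg x_2\vee\bigvee_i y_i$ (double negations removed), and $x\to\bigwedge_i y_i$ stands for $\bigwedge_i(\neg x\vee y_i)$; an empty conjunction is $\top$ and an empty disjunction is $\bot$. SAT decoding. For a set of literals $\mathcal{M}$, $\Phi^{-1}(\Pi,h,\mathcal{M})$ is the concatenation of the lists $L_0,L_1,\dots,L_{h-1}$, where $L_t$ is an arbitrary duplicate-free listing of $\{op\in O\mid op^t\in\mathcal{M}\}$. DIMACS. A DIMACS-CNF AST is a list of lists of non-zero integers (clauses). A list $[l_1,\dots,l_m]$ of non-zero integers is a model for it iff every clause contains some $l_j$, and $l_j\neq-l_k$ for all $j,k$. Fix arbitrary orderings of $V$ and $O$ with $0$-based indices $v_i$ and $op_i$. For $0\le t\le h$ let $\mathrm{int}(op^t)=1+t+op_i(h+1)$ and $\mathrm{int}(v^t)=1+|O|(h+1)+t+v_i(h+1)$. For a conjunction-free CNF part $\phi$: $\mathrm{simpORs}(\phi_1\vee\phi_2)=\mathrm{simpORs}(\phi_1)$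 appended with $\mathrm{simpORs}(\phi_2)$; $\mathrm{simpORs}(\bot)=[\,]$; $\mathrm{simpORs}(\top)=[-1,1]$; $\mathrm{simpORs}(\neg a)=[-\mathrm{int}(a)]$ and $\mathrm{simpORs}(a)=[\mathrm{int}(a)]$ for an atom $a$. $\mathrm{simp}(\phi_1\wedge\phi_2)$ is $\mathrm{simp}(\phi_1)$ appended with $\mathrm{simp}(\phi_2)$, and $\mathrm{simp}(\phi)=[\mathrm{simpORs}(\phi)]$ otherwise. For a non-zero integer $n$ with $|n|\le(|O|+|V|)(h+1)$, $\mathrm{lit}(n)$ is the literal $a$ if $n>0$ and $\neg a$ if $n<0$, where $a$ is the unique $op^t$ or $v^t$ ($0\le t\le h$) with $\mathrm{int}(a)=|n|$; integers outside this range are ignored. *)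

theory Defs
  imports Main
begin

section \<open>Mappings\<close>

text \<open>A mapping is kept as its set of maplets (rather than as a function into an option type),
  because encodings and state updates are set operations on maplets whose results are
  single-valued only under further hypotheses.\<close>

type_synonym ('v, 'a) maplets = "('v \<times> 'a) set"

definition mapping :: "('v, 'a) maplets \<Rightarrow> bool" where
  "mapping f \<longleftrightarrow> finite f \<and> single_valued f"

definition val :: "('v, 'a) maplets \<Rightarrow> 'v \<Rightarrow> 'a" where
  "val f v = (THE a. (v, a) \<in> f)"

definition choice_fun :: "('a set \<Rightarrow> 'a) \<Rightarrow> bool" where
  "choice_fun ch \<longleftrightarrow> (\<forall>s. s \<noteq> {} \<longrightarrow> ch s \<in> s)"

definition listing_fun :: "('a set \<Rightarrow> 'a list) \<Rightarrow> bool" where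
  "listing_fun ls \<longleftrightarrow> (\<forall>s. finite s \<longrightarrow> distinct (ls s) \<and> set (ls s) = s)"


section \<open>FD-AST problems\<close>

type_synonym nmap = "(nat, nat) maplets"
type_synonym ast_effect = "nmap \<times> nat \<times> nat \<times> nat"
type_synonym ast_op = "string \<times> nmap \<times> ast_effect set"

text \<open>Components: variables with the sizes of their ranges, initial state, goal, operators.\<close>

type_synonym ast_problem = "nmap \<times> nmap \<times> nmap \<times> ast_op set"

fun fd_ast :: "ast_problem \<Rightarrow> bool" where
  "fd_ast (V, I, G, ops) \<longleftrightarrow> mapping V \<and> mapping I \<and> mapping G \<and> finite ops \<and>
     (\<forall>(name, ps, es) \<in> ops. mapping ps \<and> finite es \<and> (\<forall>(epre, v, l, m) \<in> es. mapping epre))"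

definition wf_pstate :: "nmap \<Rightarrow> nmap \<Rightarrow> bool" where
  "wf_pstate V s \<longleftrightarrow> Domain s \<subseteq> Domain V \<and> (\<forall>v \<in> Domain s. val s v < val V v)"

definition wf_state :: "nmap \<Rightarrow> nmap \<Rightarrow> bool" where
  "wf_state V s \<longleftrightarrow> wf_pstate V s \<and> Domain s = Domain V"

fun eff_var :: "ast_effect \<Rightarrow> nat" where
  "eff_var (epre, v, l, m) = v"

fun op_name :: "ast_op \<Rightarrow> string" where
  "op_name (name, ps, es) = name"

fun wf_op :: "nmap \<Rightarrow> ast_op \<Rightarrow> bool" where
  "wf_op V (name, ps, es) \<longleftrightarrow> wf_pstate V ps \<and>
     (\<forall>e1 \<in> es. \<forall>e2 \<in> es. e1 \<noteq> e2 \<longrightarrow> eff_var e1 \<noteq> eff_var e2) \<and>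
     (\<forall>(epre, v, l, m) \<in> es. v \<in> Domain V \<and> wf_pstate V epre \<and> l < val V v \<and> m < val V v)"

fun wf_problem :: "ast_problem \<Rightarrow> bool" where
  "wf_problem (V, I, G, ops) \<longleftrightarrow> wf_state V I \<and> wf_pstate V G \<and>
     (\<forall>o1 \<in> ops. \<forall>o2 \<in> ops. o1 \<noteq> o2 \<longrightarrow> op_name o1 \<noteq> op_name o2) \<and>
     (\<forall>op \<in> ops. wf_op V op)"

fun valid_problem :: "ast_problem \<Rightarrow> bool" where
  "valid_problem (V, I, G, ops) \<longleftrightarrow> wf_problem (V, I, G, ops) \<and>
     (\<forall>(name, ps, es) \<in> ops. \<forall>(epre, v, l, m) \<in> es.
        epre = {} \<and> (v \<in> Domain ps \<longrightarrow> val ps v = l))"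


subsection \<open>Execution and plans\<close>

fun executable :: "ast_op \<Rightarrow> nmap \<Rightarrow> bool" where
  "executable (name, ps, es) s \<longleftrightarrow> ps \<subseteq> s \<and> (\<forall>(epre, v, l, m) \<in> es. (v, l) \<in> s)"

fun result :: "ast_op \<Rightarrow> nmap \<Rightarrow> nmap" where
  "result (name, ps, es) s =
     (s - {(v, l) | epre v l m. (epre, v, l, m) \<in> es \<and> epre \<subseteq> s})
     \<union> {(v, m) | epre v l m. (epre, v, l, m) \<in> es \<and> epre \<subseteq> s}"

fun leads_to :: "nmap \<Rightarrow> ast_op list \<Rightarrow> nmap \<Rightarrow> bool" where
  "leads_to s [] s' \<longleftrightarrow> s' = s"
| "leads_to s (op # \<pi>) s' \<longleftrightarrow> executable op s \<and> leads_to (result op s) \<pi> s'"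

fun is_plan :: "ast_problem \<Rightarrow> string list \<Rightarrow> bool" where
  "is_plan (V, I, G, ops) names \<longleftrightarrow>
     (\<exists>\<pi> s. set \<pi> \<subseteq> ops \<and> map op_name \<pi> = names \<and> leads_to I \<pi> s \<and> G \<subseteq> s)"


section \<open>FDR and STRIPS problems\<close>

text \<open>An FDR operator is a pair of precondition and effect.\<close>

type_synonym ('v, 'a) fdr_op = "('v, 'a) maplets \<times> ('v, 'a) maplets"

text \<open>Components: variables, ranges, initial state, operators, goal.\<close>

type_synonym ('v, 'a) fdr =
  "'v set \<times> ('v \<Rightarrow> 'a set) \<times> ('v, 'a) maplets \<times> ('v, 'a) fdr_op set \<times> ('v, 'a) maplets"

text \<open>In a STRIPS problem all ranges consist of the two truth values.\<close>

type_synonym 'v strips_op = "('v, bool) fdr_op"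
type_synonym 'v strips = "('v, bool) fdr"


subsection \<open>From FD-AST to FDR\<close>

fun fdr_op_of :: "ast_op \<Rightarrow> (nat, nat) fdr_op" where
  "fdr_op_of (name, ps, es) =
     (ps \<union> {(v, l) | epre v l m. (epre, v, l, m) \<in> es},
      {(v, m) | epre v l m. (epre, v, l, m) \<in> es})"

fun fdr_of :: "ast_problem \<Rightarrow> (nat, nat) fdr" where
  "fdr_of (V, I, G, ops) = (Domain V, \<lambda>v. {0..<val V v}, I, fdr_op_of ` ops, G)"

fun ast_of :: "(string set \<Rightarrow> string) \<Rightarrow> ast_problem \<Rightarrow> (nat, nat) fdr_op \<Rightarrow> string" where
  "ast_of ch (V, I, G, ops) op =
     ch {name. \<exists>ps es. (name, ps, es) \<in> ops \<and> fdr_op_of (name, ps, es) = op}"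


subsection \<open>From FDR to STRIPS\<close>

definition strips_pstate ::
    "'v set \<Rightarrow> ('v \<Rightarrow> 'a set) \<Rightarrow> ('v, 'a) maplets \<Rightarrow> ('v \<times> 'a, bool) maplets" where
  "strips_pstate V R s =
     {((v, a), True) | v a. v \<in> Domain s \<and> val s v = a}
     \<union> {((v, a), False) | v a. v \<in> Domain s \<inter> V \<and> a \<in> R v \<and> val s v \<noteq> a}"

fun strips_of :: "('v, 'a) fdr \<Rightarrow> ('v \<times> 'a) strips" where
  "strips_of (V, R, I, ops, G) =
     ({(v, a). v \<in> V \<and> a \<in> R v},
      \<lambda>_. {False, True},
      strips_pstate V R I,
      {(strips_pstate V R p, strips_pstate V R e) | p e. (p, e) \<in> ops},
      strips_pstate V R G)"

fun strips_op_inv :: "('v \<times> 'a) strips_op \<Rightarrow> ('v, 'a) fdr_op" where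
  "strips_op_inv (p, e) =
     ({(v, a). ((v, a), True) \<in> p}, {(v, a). ((v, a), True) \<in> e})"


section \<open>Propositional formulas\<close>

datatype 'x literal = Pos 'x | Neg 'x

fun neg :: "'x literal \<Rightarrow> 'x literal" where
  "neg (Pos a) = Neg a"
| "neg (Neg a) = Pos a"

datatype 'x form = Top | Bot | Lit "'x literal" | And "'x form" "'x form" | Or "'x form" "'x form"

fun big_and :: "'x form list \<Rightarrow> 'x form" where
  "big_and [] = Top"
| "big_and [\<phi>] = \<phi>"
| "big_and (\<phi> # \<psi> # \<phi>s) = And \<phi> (big_and (\<psi> # \<phi>s))"

fun big_or :: "'x form list \<Rightarrow> 'x form" where
  "big_or [] = Bot"
| "big_or [\<phi>] = \<phi>"
| "big_or (\<phi> # \<psi> # \<phi>s) = Or \<phi> (big_or (\<psi> # \<phi>s))"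

text \<open>The clausal form of an implication from a literal to a conjunction of literals: the
  implication is distributed over the conjuncts, and the empty conjunction stays empty.\<close>

fun imp_conj :: "'x literal \<Rightarrow> 'x form \<Rightarrow> 'x form" where
  "imp_conj x Top = Top"
| "imp_conj x (And \<phi> \<psi>) = And (imp_conj x \<phi>) (imp_conj x \<psi>)"
| "imp_conj x \<phi> = Or (Lit (neg x)) \<phi>"

text \<open>The clausal form of an implication from a conjunction of two literals to a disjunction.\<close>

definition imp_disj :: "'x literal \<Rightarrow> 'x literal \<Rightarrow> 'x form \<Rightarrow> 'x form" where
  "imp_disj x y \<phi> = Or (Lit (neg x)) (Or (Lit (neg y)) \<phi>)"


section \<open>SAT encoding of STRIPS problems\<close>

datatype 'v atom = VarAt 'v nat | OpAt "'v strips_op" nat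

definition interfering :: "'v strips_op \<Rightarrow> 'v strips_op \<Rightarrow> bool" where
  "interfering o1 o2 \<longleftrightarrow> o1 \<noteq> o2 \<and>
     ({v. (v, True) \<in> fst o1} \<inter> {v. (v, False) \<in> snd o2} \<noteq> {} \<or>
      {v. (v, True) \<in> fst o2} \<inter> {v. (v, False) \<in> snd o1} \<noteq> {})"

definition intrfr :: "'v strips_op set \<Rightarrow> ('v strips_op \<times> 'v strips_op) set" where
  "intrfr ops = {(o1, o2). o1 \<in> ops \<and> o2 \<in> ops \<and> interfering o1 o2}"

definition adding :: "'v strips_op set \<Rightarrow> 'v \<Rightarrow> 'v strips_op set" where
  "adding ops v = {(p, e) \<in> ops. (v, True) \<in> e}"

definition deleting :: "'v strips_op set \<Rightarrow> 'v \<Rightarrow> 'v strips_op set" where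
  "deleting ops v = {(p, e) \<in> ops. (v, False) \<in> e}"

text \<open>The parameters \<open>lv\<close>, \<open>lo\<close> and \<open>lp\<close> fix the order in which conjunctions and disjunctions
  over finite sets of variables, operators and pairs of operators are written down.\<close>

definition pstate_form :: "('v set \<Rightarrow> 'v list) \<Rightarrow> ('v, bool) maplets \<Rightarrow> nat \<Rightarrow> 'v atom form" where
  "pstate_form lv s t =
     And (big_and [Lit (Pos (VarAt v t)). v \<leftarrow> lv {v. (v, True) \<in> s}])
         (big_and [Lit (Neg (VarAt v t)). v \<leftarrow> lv {v. (v, False) \<in> s}])"

fun sat_encoding ::
    "('v set \<Rightarrow> 'v list) \<Rightarrow> ('v strips_op set \<Rightarrow> 'v strips_op list) \<Rightarrow>
     (('v strips_op \<times> 'v strips_op) set \<Rightarrow> ('v strips_op \<times> 'v strips_op) list) \<Rightarrow>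
     'v strips \<Rightarrow> nat \<Rightarrow> 'v atom form" where
  "sat_encoding lv lo lp (V, R, I, ops, G) h = big_and (
     [pstate_form lv I 0, pstate_form lv G h]
     @ [And (imp_conj (Pos (OpAt op t)) (pstate_form lv (fst op) t))
            (imp_conj (Pos (OpAt op t)) (pstate_form lv (snd op) (t + 1))).
          t \<leftarrow> [0..<h], op \<leftarrow> lo ops]
     @ [imp_disj (Neg (VarAt v (t - 1))) (Pos (VarAt v t))
            (big_or [Lit (Pos (OpAt op (t - 1))). op \<leftarrow> lo (adding ops v)]).
          t \<leftarrow> [1..<h + 1], v \<leftarrow> lv V]
     @ [imp_disj (Pos (VarAt v (t - 1))) (Neg (VarAt v t))
            (big_or [Lit (Pos (OpAt op (t - 1))). op \<leftarrow> lo (deleting ops v)]).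
          t \<leftarrow> [1..<h + 1], v \<leftarrow> lv V]
     @ [Or (Lit (Neg (OpAt o1 t))) (Lit (Neg (OpAt o2 t))).
          t \<leftarrow> [0..<h], (o1, o2) \<leftarrow> lp (intrfr ops)])"

text \<open>The parameter \<open>lt\<close> gives, for each step separately, the order of the operators of
  that step.\<close>

fun sat_decoding ::
    "(nat \<Rightarrow> 'v strips_op set \<Rightarrow> 'v strips_op list) \<Rightarrow>
     'v strips \<Rightarrow> nat \<Rightarrow> 'v atom literal set \<Rightarrow> 'v strips_op list" where
  "sat_decoding lt (V, R, I, ops, G) h M =
     concat [lt t {op \<in> ops. Pos (OpAt op t) \<in> M}. t \<leftarrow> [0..<h]]"


section \<open>DIMACS-CNF\<close>

definition dimacs_model :: "int list \<Rightarrow> int list list \<Rightarrow> bool" where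
  "dimacs_model ls cs \<longleftrightarrow> 0 \<notin> set ls \<and>
     (\<forall>c \<in> set cs. \<exists>l \<in> set ls. l \<in> set c) \<and>
     (\<forall>l \<in> set ls. \<forall>l' \<in> set ls. l \<noteq> - l')"

fun vars_of :: "('v, 'a) fdr \<Rightarrow> 'v set" where
  "vars_of (V, R, I, ops, G) = V"

fun ops_of :: "('v, 'a) fdr \<Rightarrow> ('v, 'a) fdr_op set" where
  "ops_of (V, R, I, ops, G) = ops"

text \<open>An ordering of a finite set, given by its 0-based indices.\<close>

definition indexing :: "('a \<Rightarrow> nat) \<Rightarrow> 'a set \<Rightarrow> bool" where
  "indexing ix S \<longleftrightarrow> bij_betw ix S {..<card S}"

fun atom_int ::
    "('v \<Rightarrow> nat) \<Rightarrow> ('v strips_op \<Rightarrow> nat) \<Rightarrow> 'v strips \<Rightarrow> nat \<Rightarrow> 'v atom \<Rightarrow> int" where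
  "atom_int iv io \<Pi> h (OpAt op t) = int (1 + t + io op * (h + 1))"
| "atom_int iv io \<Pi> h (VarAt v t) = int (1 + card (ops_of \<Pi>) * (h + 1) + t + iv v * (h + 1))"

text \<open>A conjunction is never passed to \<open>simp_ors\<close>.\<close>

fun simp_ors :: "('x \<Rightarrow> int) \<Rightarrow> 'x form \<Rightarrow> int list" where
  "simp_ors f (Or \<phi> \<psi>) = simp_ors f \<phi> @ simp_ors f \<psi>"
| "simp_ors f Bot = []"
| "simp_ors f Top = [-1, 1]"
| "simp_ors f (Lit (Neg a)) = [- f a]"
| "simp_ors f (Lit (Pos a)) = [f a]"

fun simp_cnf :: "('x \<Rightarrow> int) \<Rightarrow> 'x form \<Rightarrow> int list list" where
  "simp_cnf f (And \<phi> \<psi>) = simp_cnf f \<phi> @ simp_cnf f \<psi>"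
| "simp_cnf f \<phi> = [simp_ors f \<phi>]"

text \<open>Operator atoms at the last time point do not occur in the encoding, but they are assigned
  integers, too.\<close>

definition atoms :: "'v strips \<Rightarrow> nat \<Rightarrow> 'v atom set" where
  "atoms \<Pi> h = {OpAt op t | op t. op \<in> ops_of \<Pi> \<and> t \<le> h}
               \<union> {VarAt v t | v t. v \<in> vars_of \<Pi> \<and> t \<le> h}"

definition lit ::
    "('v \<Rightarrow> nat) \<Rightarrow> ('v strips_op \<Rightarrow> nat) \<Rightarrow> 'v strips \<Rightarrow> nat \<Rightarrow> int \<Rightarrow> 'v atom literal" where
  "lit iv io \<Pi> h n =
     (let a = (THE a. a \<in> atoms \<Pi> h \<and> atom_int iv io \<Pi> h a = \<bar>n\<bar>)
      in if n > 0 then Pos a else Neg a)"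

definition lits ::
    "('v \<Rightarrow> nat) \<Rightarrow> ('v strips_op \<Rightarrow> nat) \<Rightarrow> 'v strips \<Rightarrow> nat \<Rightarrow> int list \<Rightarrow> 'v atom literal set"
  where
  "lits iv io \<Pi> h ns = lit iv io \<Pi> h `
     {n \<in> set ns. n \<noteq> 0 \<and> \<bar>n\<bar> \<le> int ((card (ops_of \<Pi>) + card (vars_of \<Pi>)) * (h + 1))}"

end

theory Submission
  imports Defs
begin

text \<open>A DIMACS model need not be total, but declaring exactly the atoms whose integers occur
  positively to be true yields a valuation that satisfies every clause; conversely, a satisfying
  valuation is written down as a list of integers. Validity of \<open>P\<close> makes executing an operator
  the same as overriding the state with the effect of its FDR operator, so it suffices to compare
  valuations with sequential executions of FDR operators. Non-interference
  lets the operators of one time step be executed in any order: no operator destroys the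
  precondition of another one, and the effects agree because they all hold at the next time point.
  The frame clauses then force the valuation at the next time point to be the resulting state.\<close>

section \<open>Valuations and DIMACS models\<close>

fun lit_true :: "('x \<Rightarrow> bool) \<Rightarrow> 'x literal \<Rightarrow> bool" where
  "lit_true M (Pos a) \<longleftrightarrow> M a"
| "lit_true M (Neg a) \<longleftrightarrow> \<not> M a"

fun sat :: "('x \<Rightarrow> bool) \<Rightarrow> 'x form \<Rightarrow> bool" where
  "sat M Top \<longleftrightarrow> True"
| "sat M Bot \<longleftrightarrow> False"
| "sat M (Lit x) \<longleftrightarrow> lit_true M x"
| "sat M (And \<phi> \<psi>) \<longleftrightarrow> sat M \<phi> \<and> sat M \<psi>"
| "sat M (Or \<phi> \<psi>) \<longleftrightarrow> sat M \<phi> \<or> sat M \<psi>"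

text \<open>Singles out the arguments on which \<open>simp_ors\<close> is specified: that function
  has no equation for \<open>And\<close>. \<open>Top\<close> still counts as a clause, since an
  empty conjunction contributes one.\<close>

fun clausal :: "'x form \<Rightarrow> bool" where
  "clausal (And \<phi> \<psi>) \<longleftrightarrow> False"
| "clausal (Or \<phi> \<psi>) \<longleftrightarrow> clausal \<phi> \<and> clausal \<psi>"
| "clausal \<phi> \<longleftrightarrow> True"

fun cnf :: "'x form \<Rightarrow> bool" where
  "cnf (And \<phi> \<psi>) \<longleftrightarrow> cnf \<phi> \<and> cnf \<psi>"
| "cnf \<phi> \<longleftrightarrow> clausal \<phi>"

lemma lit_true_neg [simp]: "lit_true M (neg x) \<longleftrightarrow> \<not> lit_true M x"
  by (cases x) auto

lemma set_literal_neg [simp]: "set_literal (neg x) = set_literal x"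
  by (cases x) auto

section \<open>Truth, shape and atoms of the derived connectives\<close>

lemma sat_big_and [simp]: "sat M (big_and \<phi>s) \<longleftrightarrow> (\<forall>\<phi> \<in> set \<phi>s. sat M \<phi>)"
  by (induction \<phi>s rule: big_and.induct) auto

lemma sat_big_or [simp]: "sat M (big_or \<phi>s) \<longleftrightarrow> (\<exists>\<phi> \<in> set \<phi>s. sat M \<phi>)"
  by (induction \<phi>s rule: big_or.induct) auto

lemma sat_imp_conj [simp]: "sat M (imp_conj x \<phi>) \<longleftrightarrow> (lit_true M x \<longrightarrow> sat M \<phi>)"
  by (induction x \<phi> rule: imp_conj.induct) auto

lemma sat_imp_disj [simp]:
  "sat M (imp_disj x y \<phi>) \<longleftrightarrow> (lit_true M x \<and> lit_true M y \<longrightarrow> sat M \<phi>)"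
  by (auto simp: imp_disj_def)

lemma cnf_big_and: "(\<And>\<phi>. \<phi> \<in> set \<phi>s \<Longrightarrow> cnf \<phi>) \<Longrightarrow> cnf (big_and \<phi>s)"
  by (induction \<phi>s rule: big_and.induct) auto

lemma clausal_big_or: "(\<And>\<phi>. \<phi> \<in> set \<phi>s \<Longrightarrow> clausal \<phi>) \<Longrightarrow> clausal (big_or \<phi>s)"
  by (induction \<phi>s rule: big_or.induct) auto

lemma cnf_imp_conj: "cnf \<phi> \<Longrightarrow> cnf (imp_conj x \<phi>)"
  by (induction x \<phi> rule: imp_conj.induct) auto

lemma set_form_big_and [simp]: "set_form (big_and \<phi>s) = (\<Union>\<phi> \<in> set \<phi>s. set_form \<phi>)"
  by (induction \<phi>s rule: big_and.induct) auto

lemma set_form_big_or [simp]: "set_form (big_or \<phi>s) = (\<Union>\<phi> \<in> set \<phi>s. set_form \<phi>)"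
  by (induction \<phi>s rule: big_or.induct) auto

lemma set_form_imp_conj: "set_form (imp_conj x \<phi>) \<subseteq> set_literal x \<union> set_form \<phi>"
  by (induction x \<phi> rule: imp_conj.induct) auto

lemma set_form_imp_disj [simp]:
  "set_form (imp_disj x y \<phi>) = set_literal x \<union> set_literal y \<union> set_form \<phi>"
  by (auto simp: imp_disj_def)

text \<open>Hitting a positive literal makes it true by the choice of the valuation; hitting a
  negative one makes its atom false, because \<open>N\<close> never contains two opposite
  integers.\<close>

lemma sat_of_simp_ors:
  assumes "clausal \<phi>" and "l \<in> set (simp_ors f \<phi>)" and "l \<in> N"
    and "\<forall>l \<in> N. \<forall>l' \<in> N. l \<noteq> - l'"
  shows "sat (\<lambda>a. f a \<in> N) \<phi>"
  using assms by (induction f \<phi> rule: simp_ors.induct) auto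

lemma simp_cnf_clausal: "clausal \<phi> \<Longrightarrow> simp_cnf f \<phi> = [simp_ors f \<phi>]"
  by (cases \<phi>) auto

lemma sat_of_dimacs_model:
  assumes "cnf \<phi>" and "dimacs_model ns (simp_cnf f \<phi>)"
  shows "sat (\<lambda>a. f a \<in> set ns) \<phi>"
proof -
  have con: "\<forall>l \<in> set ns. \<forall>l' \<in> set ns. l \<noteq> - l'"
    and cl: "\<forall>c \<in> set (simp_cnf f \<phi>). \<exists>l \<in> set ns. l \<in> set c"
    using assms(2) by (auto simp: dimacs_model_def)
  have clause: "sat (\<lambda>a. f a \<in> set ns) \<psi>"
    if "clausal \<psi>" "\<forall>c \<in> set (simp_cnf f \<psi>). \<exists>l \<in> set ns. l \<in> set c" for \<psi>
    using that sat_of_simp_ors[OF _ _ _ con] by (fastforce simp: simp_cnf_clausal)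
  show ?thesis
    using assms(1) cl
  proof (induction \<phi>)
    case (And \<phi> \<psi>)
    then show ?case by auto
  qed (auto intro!: clause simp del: sat.simps simp_ors.simps)
qed

text \<open>Each atom of \<open>A\<close> is listed with the sign of its truth value. As the numbers
  are positive and pairwise distinct, no two entries are opposite, and each clause is hit through
  one of its true disjuncts.\<close>

lemma dimacs_model_of_sat:
  assumes "cnf \<phi>" and "sat M \<phi>" and "set_form \<phi> \<subseteq> A"
    and "finite A" and "inj_on f A" and pos: "\<And>a. a \<in> A \<Longrightarrow> f a > 0"
  shows "\<exists>ns. dimacs_model ns (simp_cnf f \<phi>)"
proof -
  define S where "S = f ` {a \<in> A. M a}"
  \<comment> \<open>The sign is a function of the number rather than of the atom, so that 1 gets
    exactly one sign whether or not it is the number of an atom.\<close>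
  define g where "g n = (if n \<in> S then n else - n)" for n
  \<comment> \<open>The clause \<open>[-1, 1]\<close> of an empty conjunction needs \<open>1\<close> or \<open>- 1\<close> even if there are no atoms.\<close>
  define ns where "ns = map g (sorted_list_of_set (insert 1 (f ` A)))"
  have set_ns: "set ns = g ` insert 1 (f ` A)"
    using \<open>finite A\<close> by (simp only: ns_def set_map set_sorted_list_of_set finite_insert finite_imageI)
  have one: "1 \<in> set ns \<or> - 1 \<in> set ns"
    by (auto simp: set_ns g_def)
  have g: "(if M a then f a else - f a) \<in> set ns" if "a \<in> A" for a
  proof -
    have "f a \<in> S \<longleftrightarrow> M a"
      using that \<open>inj_on f A\<close> by (auto simp: S_def inj_on_def)
    then show ?thesis using that by (auto simp: set_ns g_def)
  qed
  have ors: "\<exists>l \<in> set ns. l \<in> set (simp_ors f \<psi>)"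
    if "clausal \<psi>" "sat M \<psi>" "set_form \<psi> \<subseteq> A" for \<psi>
    using that
  proof (induction \<psi>)
    case (Lit x)
    \<comment> \<open>\<open>set_literal x\<close> is a singleton, and its element is the atom of
      the literal.\<close>
    then show ?case using g[of "the_elem (set_literal x)"] by (cases x) auto
  qed (use one in auto)
  have clause: "\<forall>c \<in> set (simp_cnf f \<psi>). \<exists>l \<in> set ns. l \<in> set c"
    if "clausal \<psi>" "sat M \<psi>" "set_form \<psi> \<subseteq> A" for \<psi>
    using ors[OF that] by (simp add: simp_cnf_clausal[OF that(1)])
  have "\<forall>c \<in> set (simp_cnf f \<phi>). \<exists>l \<in> set ns. l \<in> set c"
    using assms(1-3)
  proof (induction \<phi>)
    case (And \<phi> \<psi>)
    then show ?case by auto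
  qed (rule clause; simp)+
  moreover have "0 \<notin> set ns"
    using pos by (force simp: set_ns g_def)
  moreover have "\<forall>l \<in> set ns. \<forall>l' \<in> set ns. l \<noteq> - l'"
  proof -
    \<comment> \<open>All numbers being positive, opposite entries could only stem from the same
      number, to which \<open>g\<close> gives a single sign.\<close>
    have "n > 0" if "n \<in> insert 1 (f ` A)" for n
      using that pos by auto
    then show ?thesis
      unfolding set_ns g_def by (smt (verit) imageE)
  qed
  ultimately show ?thesis
    unfolding dimacs_model_def by blast
qed


section \<open>Valuations satisfying the SAT encoding\<close>

definition holds_at :: "('v atom \<Rightarrow> bool) \<Rightarrow> nat \<Rightarrow> ('v, bool) maplets \<Rightarrow> bool" where
  "holds_at M t s \<longleftrightarrow> (\<forall>(v, b) \<in> s. M (VarAt v t) = b)"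

text \<open>The semantic content of the encoding, free of listing orders. The frame conditions run
  over \<open>t < h\<close> and look forward to \<open>Suc t\<close>, whereas the frame clauses run
  over 1 to \<open>h\<close> and look back to \<open>t - 1\<close>.\<close>

fun strips_model :: "('v atom \<Rightarrow> bool) \<Rightarrow> 'v strips \<Rightarrow> nat \<Rightarrow> bool" where
  "strips_model M (V, R, I, ops, G) h \<longleftrightarrow>
     holds_at M 0 I \<and> holds_at M h G \<and>
     (\<forall>t < h. \<forall>op \<in> ops. M (OpAt op t) \<longrightarrow> holds_at M t (fst op) \<and> holds_at M (Suc t) (snd op)) \<and>
     (\<forall>t < h. \<forall>v \<in> V. \<not> M (VarAt v t) \<and> M (VarAt v (Suc t)) \<longrightarrow>
        (\<exists>op \<in> ops. (v, True) \<in> snd op \<and> M (OpAt op t))) \<and>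
     (\<forall>t < h. \<forall>v \<in> V. M (VarAt v t) \<and> \<not> M (VarAt v (Suc t)) \<longrightarrow>
        (\<exists>op \<in> ops. (v, False) \<in> snd op \<and> M (OpAt op t))) \<and>
     (\<forall>t < h. \<forall>op \<in> ops. \<forall>op' \<in> ops. interfering op op' \<longrightarrow> \<not> (M (OpAt op t) \<and> M (OpAt op' t)))"

text \<open>Finiteness matters because the listing functions are unspecified on infinite sets.\<close>

fun strips_finite :: "'v strips \<Rightarrow> bool" where
  "strips_finite (V, R, I, ops, G) \<longleftrightarrow> finite V \<and> finite I \<and> finite ops \<and> finite G \<and>
     Domain I \<subseteq> V \<and> Domain G \<subseteq> V \<and>
     (\<forall>op \<in> ops. finite (fst op) \<and> Domain (fst op) \<subseteq> V \<and>
        finite (snd op) \<and> Domain (snd op) \<subseteq> V)"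

lemma set_listing: "listing_fun ls \<Longrightarrow> finite S \<Longrightarrow> set (ls S) = S"
  by (simp add: listing_fun_def)

lemma distinct_listing: "listing_fun ls \<Longrightarrow> finite S \<Longrightarrow> distinct (ls S)"
  by (simp add: listing_fun_def)

lemma finite_maplet_preimage: "finite s \<Longrightarrow> finite {v. (v, b) \<in> s}"
  by (rule finite_subset[of _ "fst ` s"]) force+

lemma intrfr_iff: "(op, op') \<in> intrfr ops \<longleftrightarrow> op \<in> ops \<and> op' \<in> ops \<and> interfering op op'"
  by (simp add: intrfr_def)

lemma finite_intrfr: "finite ops \<Longrightarrow> finite (intrfr ops)"
  by (rule finite_subset[of _ "ops \<times> ops"]) (auto simp: intrfr_def)

lemma adding_iff: "op \<in> adding ops v \<longleftrightarrow> op \<in> ops \<and> (v, True) \<in> snd op"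
  by (cases op) (simp add: adding_def)

lemma deleting_iff: "op \<in> deleting ops v \<longleftrightarrow> op \<in> ops \<and> (v, False) \<in> snd op"
  by (cases op) (simp add: deleting_def)

lemma finite_adding: "finite ops \<Longrightarrow> finite (adding ops v)"
  by (rule finite_subset[of _ ops]) (auto simp: adding_iff)

lemma finite_deleting: "finite ops \<Longrightarrow> finite (deleting ops v)"
  by (rule finite_subset[of _ ops]) (auto simp: deleting_iff)

lemma sat_pstate_form:
  assumes "listing_fun lv" and "finite s"
  shows "sat M (pstate_form lv s t) \<longleftrightarrow> holds_at M t s"
  using assms
  by (auto simp: pstate_form_def holds_at_def set_listing finite_maplet_preimage)
     (metis (full_types))+

lemma cnf_pstate_form: "cnf (pstate_form lv s t)"
  by (auto simp: pstate_form_def intro!: cnf_big_and)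

lemma set_pstate_form:
  assumes "listing_fun lv" and "finite s"
  shows "set_form (pstate_form lv s t) \<subseteq> {VarAt v t | v. v \<in> Domain s}"
  using assms by (auto simp: pstate_form_def set_listing finite_maplet_preimage)

text \<open>The only conjunctions below an implication are those of \<open>pstate_form\<close>, and
  \<open>imp_conj\<close> pushes the implication through them; the remaining parts are disjunctions
  of literals.\<close>

lemma cnf_sat_encoding: "cnf (sat_encoding lv lo lp \<Pi> h)"
proof -
  obtain V R I ops G where \<Pi>: "\<Pi> = (V, R, I, ops, G)"
    by (metis prod_cases5)
  show ?thesis
    unfolding \<Pi> sat_encoding.simps
    by (rule cnf_big_and)
       (auto simp: cnf_pstate_form imp_disj_def intro!: cnf_imp_conj clausal_big_or)
qed

lemma sat_encoding_iff:
  assumes "listing_fun lv" and "listing_fun lo" and "listing_fun lp" and "strips_finite \<Pi>"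
  shows "sat M (sat_encoding lv lo lp \<Pi> h) \<longleftrightarrow> strips_model M \<Pi> h"
proof -
  obtain V R I ops G where \<Pi>: "\<Pi> = (V, R, I, ops, G)"
    by (metis prod_cases5)
  have fin: "finite V" "finite I" "finite ops" "finite G"
    "\<And>op. op \<in> ops \<Longrightarrow> finite (fst op)" "\<And>op. op \<in> ops \<Longrightarrow> finite (snd op)"
    using assms(4) by (auto simp: \<Pi>)
  \<comment> \<open>Reindexes the frame clauses by the earlier of their two time points.\<close>
  have frame: "(\<forall>t \<in> {1..<h+1}. Q t) \<longleftrightarrow> (\<forall>t < h. Q (Suc t))" for Q
  proof -
    have "{1..<h+1} = Suc ` {..<h}"
      by (simp add: image_Suc_lessThan atLeastLessThanSuc_atLeastAtMost)
    then show ?thesis by auto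
  qed
  have op: "(\<forall>t \<in> {0..<h}. \<forall>op \<in> ops. sat M (And (imp_conj (Pos (OpAt op t)) (pstate_form lv (fst op) t))
            (imp_conj (Pos (OpAt op t)) (pstate_form lv (snd op) (t + 1))))) \<longleftrightarrow>
     (\<forall>t < h. \<forall>op \<in> ops. M (OpAt op t) \<longrightarrow> holds_at M t (fst op) \<and> holds_at M (Suc t) (snd op))"
    using fin(5,6) by (auto simp: sat_pstate_form[OF assms(1)])
  have add: "(\<forall>t \<in> {1..<h+1}. \<forall>v \<in> V. sat M (imp_disj (Neg (VarAt v (t - 1))) (Pos (VarAt v t))
            (big_or [Lit (Pos (OpAt op (t - 1))). op \<leftarrow> lo (adding ops v)]))) \<longleftrightarrow>
     (\<forall>t < h. \<forall>v \<in> V. \<not> M (VarAt v t) \<and> M (VarAt v (Suc t)) \<longrightarrow>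
        (\<exists>op \<in> ops. (v, True) \<in> snd op \<and> M (OpAt op t)))"
    unfolding frame
    by (auto simp: set_listing[OF assms(2) finite_adding[OF fin(3)]] Bex_def adding_iff)
  have del: "(\<forall>t \<in> {1..<h+1}. \<forall>v \<in> V. sat M (imp_disj (Pos (VarAt v (t - 1))) (Neg (VarAt v t))
            (big_or [Lit (Pos (OpAt op (t - 1))). op \<leftarrow> lo (deleting ops v)]))) \<longleftrightarrow>
     (\<forall>t < h. \<forall>v \<in> V. M (VarAt v t) \<and> \<not> M (VarAt v (Suc t)) \<longrightarrow>
        (\<exists>op \<in> ops. (v, False) \<in> snd op \<and> M (OpAt op t)))"
    unfolding frame
    by (auto simp: set_listing[OF assms(2) finite_deleting[OF fin(3)]] Bex_def deleting_iff)
  have int: "(\<forall>t \<in> {0..<h}. \<forall>x \<in> intrfr ops.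
        sat M (case x of (o1, o2) \<Rightarrow> Or (Lit (Neg (OpAt o1 t))) (Lit (Neg (OpAt o2 t))))) \<longleftrightarrow>
     (\<forall>t < h. \<forall>op \<in> ops. \<forall>op' \<in> ops. interfering op op' \<longrightarrow> \<not> (M (OpAt op t) \<and> M (OpAt op' t)))"
    by (auto simp: intrfr_def)
  \<comment> \<open>Splits the conjunction into its six blocks, each left in the exact form of the
    left-hand sides of \<open>op\<close>, \<open>add\<close>, \<open>del\<close> and
    \<open>int\<close>.\<close>
  have "sat M (sat_encoding lv lo lp \<Pi> h) \<longleftrightarrow>
      sat M (pstate_form lv I 0) \<and> sat M (pstate_form lv G h) \<and>
      (\<forall>t \<in> {0..<h}. \<forall>op \<in> ops. sat M (And (imp_conj (Pos (OpAt op t)) (pstate_form lv (fst op) t))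
            (imp_conj (Pos (OpAt op t)) (pstate_form lv (snd op) (t + 1))))) \<and>
      (\<forall>t \<in> {1..<h+1}. \<forall>v \<in> V. sat M (imp_disj (Neg (VarAt v (t - 1))) (Pos (VarAt v t))
            (big_or [Lit (Pos (OpAt op (t - 1))). op \<leftarrow> lo (adding ops v)]))) \<and>
      (\<forall>t \<in> {1..<h+1}. \<forall>v \<in> V. sat M (imp_disj (Pos (VarAt v (t - 1))) (Neg (VarAt v t))
            (big_or [Lit (Pos (OpAt op (t - 1))). op \<leftarrow> lo (deleting ops v)]))) \<and>
      (\<forall>t \<in> {0..<h}. \<forall>x \<in> intrfr ops.
        sat M (case x of (o1, o2) \<Rightarrow> Or (Lit (Neg (OpAt o1 t))) (Lit (Neg (OpAt o2 t)))))"
    by (simp only: \<Pi> sat_encoding.simps sat_big_and set_append ball_Un set_concat set_map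
      set_listing[OF assms(2) fin(3)] set_listing[OF assms(1) fin(1)]
      set_listing[OF assms(3) finite_intrfr[OF fin(3)]] set_upt list.set ball_simps ball_UN simp_thms
      conj_assoc)
  then show ?thesis
    unfolding \<Pi> strips_model.simps op add del int
      sat_pstate_form[OF assms(1) fin(2)] sat_pstate_form[OF assms(1) fin(4)] .
qed

lemma OpAt_in_atoms: "OpAt op t \<in> atoms \<Pi> h \<longleftrightarrow> op \<in> ops_of \<Pi> \<and> t \<le> h"
  and VarAt_in_atoms: "VarAt v t \<in> atoms \<Pi> h \<longleftrightarrow> v \<in> vars_of \<Pi> \<and> t \<le> h"
  by (simp_all add: atoms_def del: split_paired_Ex)

text \<open>Confines the encoding to \<open>atoms\<close>, the set on which the numbering is
  injective and positive.\<close>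

lemma set_sat_encoding:
  assumes "listing_fun lv" and "listing_fun lo" and "listing_fun lp" and "strips_finite \<Pi>"
  shows "set_form (sat_encoding lv lo lp \<Pi> h) \<subseteq> atoms \<Pi> h"
proof -
  obtain V R I ops G where \<Pi>: "\<Pi> = (V, R, I, ops, G)"
    by (metis prod_cases5)
  have fin: "finite V" "finite I" "finite ops" "finite G"
    and dom: "Domain I \<subseteq> V" "Domain G \<subseteq> V"
    and op: "\<forall>op \<in> ops. finite (fst op) \<and> Domain (fst op) \<subseteq> V \<and>
        finite (snd op) \<and> Domain (snd op) \<subseteq> V"
    using assms(4) by (simp_all add: \<Pi>)
  have ps: "set_form (pstate_form lv s t) \<subseteq> atoms \<Pi> h"
    if "finite s" "Domain s \<subseteq> V" "t \<le> h" for s t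
    using set_pstate_form[OF assms(1) that(1), of t] that by (force simp: atoms_def \<Pi>)
  have opf: "set_form (imp_conj (Pos (OpAt op t)) (pstate_form lv s t')) \<subseteq> atoms \<Pi> h"
    if "op \<in> ops" "t < h" "finite s" "Domain s \<subseteq> V" "t' \<le> h" for op t s t'
  proof -
    have "OpAt op t \<in> atoms \<Pi> h" using that(1,2) by (simp add: OpAt_in_atoms \<Pi>)
    then show ?thesis
      using set_form_imp_conj[of "Pos (OpAt op t)" "pstate_form lv s t'"] ps[OF that(3-5)] by auto
  qed
  have "set_form (imp_conj (Pos (OpAt op t)) (pstate_form lv (fst op) t)) \<subseteq> atoms \<Pi> h"
    and "set_form (imp_conj (Pos (OpAt op t)) (pstate_form lv (snd op) (Suc t))) \<subseteq> atoms \<Pi> h"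
    if "t < h" "op \<in> ops" for op t
    using op that by (simp_all add: opf)
  note opf' = this
  show ?thesis
    unfolding \<Pi> sat_encoding.simps set_form_big_and set_append UN_Un
    unfolding \<Pi>[symmetric]
  proof (intro Un_least)
    show "\<Union> (set_form ` set [pstate_form lv I 0, pstate_form lv G h]) \<subseteq> atoms \<Pi> h"
      using ps[OF fin(2) dom(1)] ps[OF fin(4) dom(2)] by simp
  next
    show "\<Union> (set_form ` set [And (imp_conj (Pos (OpAt op t)) (pstate_form lv (fst op) t))
            (imp_conj (Pos (OpAt op t)) (pstate_form lv (snd op) (t + 1))).
          t \<leftarrow> [0..<h], op \<leftarrow> lo ops]) \<subseteq> atoms \<Pi> h"
      by (simp add: set_listing[OF assms(2) fin(3)] UN_subset_iff opf')
  qed (auto simp: atoms_def \<Pi> set_listing[OF assms(1) fin(1)] set_listing[OF assms(2)]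
         set_listing[OF assms(3) finite_intrfr[OF fin(3)]] finite_adding[OF fin(3)]
         finite_deleting[OF fin(3)] adding_iff deleting_iff intrfr_iff)
qed


section \<open>Numbering of the atoms\<close>

text \<open>\<open>r\<close> and \<open>q\<close> are remainder and quotient on division by
  \<open>k\<close>.\<close>

lemma mult_add_eq_iff:
  fixes q r k :: nat
  assumes "r < k" and "r' < k"
  shows "r + q * k = r' + q' * k \<longleftrightarrow> r = r' \<and> q = q'"
proof -
  have "(r + q * k) mod k = r" "(r + q * k) div k = q"
    "(r' + q' * k) mod k = r'" "(r' + q' * k) div k = q'"
    using assms by auto
  then show ?thesis by metis
qed

lemma atom_index_bound:
  fixes q r k n :: nat
  assumes "r < k" and "q < n"
  shows "r + q * k < n * k"
proof -
  have "r + q * k < Suc q * k" using assms(1) by simp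
  also have "\<dots> \<le> n * k" using assms(2) by (intro mult_le_mono1) simp
  finally show ?thesis .
qed

text \<open>Up to the shift by 1, an atom number is \<open>r + q * k\<close> with
  \<open>k = h + 1\<close>, where \<open>r\<close> is the time point and \<open>q\<close> a joint
  index of operators and variables. Division with remainder inverts this.\<close>

lemma atom_int_bij:
  assumes iv: "indexing iv (vars_of \<Pi>)" and io: "indexing io (ops_of \<Pi>)"
  shows "bij_betw (atom_int iv io \<Pi> h) (atoms \<Pi> h)
    {1..int ((card (ops_of \<Pi>) + card (vars_of \<Pi>)) * (h + 1))}"
proof -
  define k where "k = h + 1"
  define m where "m = card (ops_of \<Pi>)"
  define n where "n = card (vars_of \<Pi>)"
  note defs = k_def[symmetric] m_def[symmetric] n_def[symmetric]
  have iv': "inj_on iv (vars_of \<Pi>)" "iv ` vars_of \<Pi> = {..<n}"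
    and io': "inj_on io (ops_of \<Pi>)" "io ` ops_of \<Pi> = {..<m}"
    using iv io by (auto simp: indexing_def bij_betw_def m_def n_def)
  have iv_less: "iv v < n" if "v \<in> vars_of \<Pi>" for v
    using iv'(2) that by auto
  have io_less: "io op < m" if "op \<in> ops_of \<Pi>" for op
    using io'(2) that by auto
  \<comment> \<open>Operators occupy the joint indices below \<open>m\<close>, variables the
    \<open>n\<close> indices from \<open>m\<close> on.\<close>
  define r where "r a = (case a of OpAt op t \<Rightarrow> t | VarAt v t \<Rightarrow> t)" for a :: "'a atom"
  define q where "q a = (case a of OpAt op t \<Rightarrow> io op | VarAt v t \<Rightarrow> m + iv v)" for a
  have atom_int: "atom_int iv io \<Pi> h a = int (Suc (r a + q a * k))" for a
    by (cases a) (simp_all add: r_def q_def k_def m_def algebra_simps)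
  have OpAt: "OpAt op t \<in> atoms \<Pi> h \<longleftrightarrow> op \<in> ops_of \<Pi> \<and> t < k"
    and VarAt: "VarAt v t \<in> atoms \<Pi> h \<longleftrightarrow> v \<in> vars_of \<Pi> \<and> t < k" for op v t
    by (auto simp: OpAt_in_atoms VarAt_in_atoms k_def)
  have less: "r a < k" "q a < m + n" if "a \<in> atoms \<Pi> h" for a
    using that by (cases a; simp add: OpAt VarAt r_def q_def iv_less io_less trans_less_add1)+
  have "inj_on (atom_int iv io \<Pi> h) (atoms \<Pi> h)"
  proof (rule inj_onI)
    fix a b
    assume ab: "a \<in> atoms \<Pi> h" "b \<in> atoms \<Pi> h" "atom_int iv io \<Pi> h a = atom_int iv io \<Pi> h b"
    then have "r a + q a * k = r b + q b * k"
      by (simp only: atom_int of_nat_eq_iff nat.inject)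
    then have "r a = r b" "q a = q b"
      using less ab(1,2) by (simp_all add: mult_add_eq_iff)
    \<comment> \<open>No operator shares its joint index with a variable, which settles the two
      mixed cases.\<close>
    moreover have "io op \<noteq> m + i" "m + i \<noteq> io op" if "op \<in> ops_of \<Pi>" for op i
      using io_less[OF that] by auto
    ultimately show "a = b"
      using ab(1,2)
      by (cases a; cases b)
        (simp_all add: OpAt VarAt r_def q_def inj_on_eq_iff[OF iv'(1)] inj_on_eq_iff[OF io'(1)])
  qed
  moreover have "atom_int iv io \<Pi> h ` atoms \<Pi> h = {1..int ((m + n) * k)}"
  proof (intro equalityI subsetI)
    fix i assume "i \<in> atom_int iv io \<Pi> h ` atoms \<Pi> h"
    then obtain a where "a \<in> atoms \<Pi> h" and i: "i = int (Suc (r a + q a * k))"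
      using atom_int by blast
    then have "r a + q a * k < (m + n) * k"
      using less by (intro atom_index_bound)
    then show "i \<in> {1..int ((m + n) * k)}"
      unfolding i by (simp del: of_nat_add of_nat_mult of_nat_Suc)
  next
    fix i assume i: "i \<in> {1..int ((m + n) * k)}"
    \<comment> \<open>\<open>j\<close> is the 0-based number: \<open>j mod k\<close> recovers the
      time point, and comparing \<open>j div k\<close> with \<open>m\<close> tells whether the atom
      belongs to an operator or to a variable.\<close>
    define j where "j = nat (i - 1)"
    have j: "j < (m + n) * k" and i_eq: "i = int (Suc (j mod k + (j div k) * k))"
      using i by (auto simp: j_def simp del: of_nat_add of_nat_mult)
    have "j mod k < k" by (simp add: k_def)
    have q: "j div k < m + n"
      using j by (simp add: less_mult_imp_div_less)
    show "i \<in> atom_int iv io \<Pi> h ` atoms \<Pi> h"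
    proof (cases "j div k < m")
      case True
      then obtain op' where "op' \<in> ops_of \<Pi>" "io op' = j div k"
        using io'(2) by (metis imageE lessThan_iff)
      then have "OpAt op' (j mod k) \<in> atoms \<Pi> h" "i = atom_int iv io \<Pi> h (OpAt op' (j mod k))"
        using \<open>j mod k < k\<close> i_eq by (simp_all add: OpAt VarAt atom_int r_def q_def del: atom_int.simps)
      then show ?thesis by blast
    next
      case False
      then have "j div k - m \<in> {..<n}" using q by auto
      then obtain v where "v \<in> vars_of \<Pi>" "iv v = j div k - m"
        using iv'(2) by (metis imageE)
      then have "VarAt v (j mod k) \<in> atoms \<Pi> h" "i = atom_int iv io \<Pi> h (VarAt v (j mod k))"
        using \<open>j mod k < k\<close> i_eq False by (simp_all add: OpAt VarAt atom_int r_def q_def del: atom_int.simps)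
      then show ?thesis by blast
    qed
  qed
  ultimately show ?thesis
    unfolding bij_betw_def defs by blast
qed

text \<open>Links the decoding to the valuation read off a DIMACS model. Surjectivity of the
  numbering ensures that \<open>lit\<close> decodes every integer in range, injectivity that the
  description in it denotes the intended atom.\<close>

lemma Pos_in_lits_iff:
  assumes "indexing iv (vars_of \<Pi>)" and "indexing io (ops_of \<Pi>)" and "a \<in> atoms \<Pi> h"
  shows "Pos a \<in> lits iv io \<Pi> h ns \<longleftrightarrow> atom_int iv io \<Pi> h a \<in> set ns"
proof -
  let ?f = "atom_int iv io \<Pi> h"
  let ?N = "int ((card (ops_of \<Pi>) + card (vars_of \<Pi>)) * (h + 1))"
  note bij = atom_int_bij[OF assms(1,2), of h]
  have the: "(THE b. b \<in> atoms \<Pi> h \<and> ?f b = ?f a) = a" if "a \<in> atoms \<Pi> h" for a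
    using that bij by (intro the_equality) (auto simp: bij_betw_def inj_on_def)
  have range: "?f a \<in> {1..?N}"
    using bij assms(3) by (auto simp: bij_betw_def)
  show ?thesis
  proof
    assume "Pos a \<in> lits iv io \<Pi> h ns"
    then obtain n where n: "n \<in> set ns" "n \<noteq> 0" "\<bar>n\<bar> \<le> ?N" "lit iv io \<Pi> h n = Pos a"
      unfolding lits_def by force
    from n(4) have "n > 0" and a: "a = (THE b. b \<in> atoms \<Pi> h \<and> ?f b = n)"
      by (auto simp: lit_def Let_def split: if_splits)
    \<comment> \<open>The bound on the absolute value puts \<open>n\<close> into the range of the
      numbering, so an atom with this number exists.\<close>
    then have "n \<in> {1..?N}"
      using n(3) by simp
    then obtain b where "b \<in> atoms \<Pi> h" "?f b = n"
      using bij by (metis bij_betw_def imageE)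
    then show "?f a \<in> set ns"
      using a the[of b] n(1) by simp
  next
    assume "?f a \<in> set ns"
    moreover have "lit iv io \<Pi> h (?f a) = Pos a"
      using range the[OF assms(3)] by (simp add: lit_def)
    ultimately show "Pos a \<in> lits iv io \<Pi> h ns"
      using range unfolding lits_def by (intro image_eqI[of _ _ "?f a"]) auto
  qed
qed


section \<open>Execution of FDR operators\<close>

text \<open>Function update in terms of maplets: old maplets are removed by variable, whatever their
  value, unlike in \<open>result\<close>.\<close>

definition override :: "('v, 'a) maplets \<Rightarrow> ('v, 'a) maplets \<Rightarrow> ('v, 'a) maplets" where
  "override s e = {(v, a) \<in> s. v \<notin> Domain e} \<union> e"

fun fdr_leads_to :: "('v, 'a) maplets \<Rightarrow> ('v, 'a) fdr_op list \<Rightarrow> ('v, 'a) maplets \<Rightarrow> bool" where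
  "fdr_leads_to s [] s' \<longleftrightarrow> s' = s"
| "fdr_leads_to s (op # \<pi>) s' \<longleftrightarrow> fst op \<subseteq> s \<and> fdr_leads_to (override s (snd op)) \<pi> s'"

lemma fdr_leads_to_append:
  "fdr_leads_to s \<pi> s' \<Longrightarrow> fdr_leads_to s' \<pi>' s'' \<Longrightarrow> fdr_leads_to s (\<pi> @ \<pi>') s''"
  by (induction \<pi> arbitrary: s) auto

lemma single_valued_override:
  "single_valued s \<Longrightarrow> single_valued e \<Longrightarrow> single_valued (override s e)"
  by (auto simp: override_def single_valued_def)

text \<open>In a single-valued \<open>s\<close>, the only maplet at a variable of \<open>d\<close>
  is the one in \<open>d\<close> itself, so removing \<open>d\<close> clears exactly its
  variables.\<close>

lemma Diff_Un_eq_override: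
  assumes "single_valued s" and "d \<subseteq> s" and "Domain d = Domain e"
  shows "(s - d) \<union> e = override s e"
proof -
  have "(v, a) \<in> d \<longleftrightarrow> v \<in> Domain e" if "(v, a) \<in> s" for v a
    using that assms single_valuedD[OF assms(1) that] by blast
  then show ?thesis by (auto simp: override_def)
qed

text \<open>\<open>e\<close> and \<open>e'\<close> agree on common variables, so whatever the second
  update removes from \<open>e\<close> it puts back.\<close>

lemma override_override:
  assumes "single_valued (e \<union> e')"
  shows "override (override s e) e' = override s (e \<union> e')"
proof -
  have "(v, a) \<in> e'" if "(v, a) \<in> e" "(v, b) \<in> e'" for v a b
    using that single_valuedD[OF assms, of v a b] by auto
  then show ?thesis by (auto simp: override_def)
qed

text \<open>Executing one operator keeps the preconditions of the others: where its effect touches a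
  variable they mention, it sets the value they require. The remaining operators are thus again
  jointly executable in the updated state.\<close>

lemma fdr_leads_to_parallel:
  assumes "distinct \<pi>" and "\<And>op. op \<in> set \<pi> \<Longrightarrow> fst op \<subseteq> s"
    and "\<And>op op' v a. \<lbrakk>op \<in> set \<pi>; op' \<in> set \<pi>; op \<noteq> op'; (v, a) \<in> fst op; v \<in> Domain (snd op')\<rbrakk>
           \<Longrightarrow> (v, a) \<in> snd op'"
    and "single_valued (\<Union>op \<in> set \<pi>. snd op)"
  shows "fdr_leads_to s \<pi> (override s (\<Union>op \<in> set \<pi>. snd op))"
  using assms
proof (induction \<pi> arbitrary: s)
  case Nil
  then show ?case by (simp add: override_def)
next
  case (Cons op \<pi>)
  let ?E = "\<Union>op \<in> set \<pi>. snd op"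
  have "fst op' \<subseteq> override s (snd op)" if "op' \<in> set \<pi>" for op'
  proof
    fix x assume x: "x \<in> fst op'"
    obtain v a where "x = (v, a)" by fastforce
    \<comment> \<open>An operator may destroy its own precondition, so no operator may occur
      twice.\<close>
    moreover have "op' \<noteq> op" using that Cons.prems(1) by auto
    ultimately show "x \<in> override s (snd op)"
      using x that Cons.prems(2)[of op'] Cons.prems(3)[of op' op v a]
      by (auto simp: override_def)
  qed
  moreover have "single_valued ?E"
    using Cons.prems(4) by (rule single_valued_subset[rotated]) auto
  ultimately have "fdr_leads_to (override s (snd op)) \<pi> (override (override s (snd op)) ?E)"
    using Cons.prems(1) by (intro Cons.IH) (simp, blast, rule Cons.prems(3), simp_all)
  moreover have "override (override s (snd op)) ?E = override s (snd op \<union> ?E)"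
    using Cons.prems(4) by (intro override_override) simp
  ultimately show ?case
    using Cons.prems(2) by simp
qed


section \<open>FDR problems and their STRIPS encoding\<close>

lemma val_eq_iff: "single_valued s \<Longrightarrow> v \<in> Domain s \<Longrightarrow> val s v = a \<longleftrightarrow> (v, a) \<in> s"
  unfolding val_def single_valued_def
  by (metis (mono_tags, lifting) DomainE theI')

definition pstate :: "'v set \<Rightarrow> ('v \<Rightarrow> 'a set) \<Rightarrow> ('v, 'a) maplets \<Rightarrow> bool" where
  "pstate V R s \<longleftrightarrow> single_valued s \<and> s \<subseteq> Sigma V R"

text \<open>Both halves of the definition merge: single-valuedness turns \<open>val\<close> into
  membership, and the range condition of the negative half holds automatically in the positive
  one.\<close>

lemma strips_pstate_iff:
  assumes "pstate V R s"
  shows "((v, a), b) \<in> strips_pstate V R s \<longleftrightarrow> v \<in> Domain s \<and> a \<in> R v \<and> (b \<longleftrightarrow> (v, a) \<in> s)"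
proof (cases "v \<in> Domain s")
  case True
  then obtain c where c: "(v, c) \<in> s" by blast
  have "(v, x) \<in> s \<longleftrightarrow> x = c" for x
    using c assms by (auto simp: pstate_def single_valued_def)
  moreover have "val s v = c"
    using c assms True by (simp add: pstate_def val_eq_iff)
  moreover have "v \<in> V" "c \<in> R v"
    using c assms by (auto simp: pstate_def)
  ultimately show ?thesis
    using True by (cases b) (auto simp: strips_pstate_def)
next
  case False
  then show ?thesis by (auto simp: strips_pstate_def)
qed

lemma Domain_pstate: "pstate V R s \<Longrightarrow> Domain s \<subseteq> V"
  by (auto simp: pstate_def)

lemma strips_pstate_subset:
  assumes "pstate V R s"
  shows "strips_pstate V R s \<subseteq> Sigma V R \<times> UNIV"
proof
  fix x assume x: "x \<in> strips_pstate V R s"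
  obtain v a b where "x = ((v, a), b)" by (metis surj_pair)
  then show "x \<in> Sigma V R \<times> UNIV"
    using x Domain_pstate[OF assms] by (auto simp: strips_pstate_iff[OF assms])
qed

lemma strips_op_inv_strips_pstate:
  assumes "pstate V R p" and "pstate V R e"
  shows "strips_op_inv (strips_pstate V R p, strips_pstate V R e) = (p, e)"
  using assms by (auto simp: strips_pstate_iff) (auto simp: pstate_def)

lemma holds_at_strips_pstate:
  assumes "pstate V R s"
  shows "holds_at M t (strips_pstate V R s) \<longleftrightarrow>
    (\<forall>v \<in> Domain s. \<forall>a \<in> R v. M (VarAt (v, a) t) \<longleftrightarrow> (v, a) \<in> s)"
proof -
  have "holds_at M t (strips_pstate V R s) \<longleftrightarrow>
    (\<forall>v a b. ((v, a), b) \<in> strips_pstate V R s \<longrightarrow> M (VarAt (v, a) t) = b)"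
    unfolding holds_at_def by auto
  then show ?thesis
    unfolding strips_pstate_iff[OF assms] by blast
qed

section \<open>The STRIPS encoding of a fixed FDR problem\<close>

locale fdr_problem =
  fixes V :: "'v set" and R :: "'v \<Rightarrow> 'a set" and I :: "('v, 'a) maplets"
    and ops :: "('v, 'a) fdr_op set" and G :: "('v, 'a) maplets"
  assumes finite_V: "finite V" and finite_R: "v \<in> V \<Longrightarrow> finite (R v)" and finite_ops: "finite ops"
    and init: "pstate V R I" and Domain_init: "Domain I = V" and goal: "pstate V R G"
    and pre: "op \<in> ops \<Longrightarrow> pstate V R (fst op)" and eff: "op \<in> ops \<Longrightarrow> pstate V R (snd op)"
begin

definition enc :: "('v, 'a) fdr_op \<Rightarrow> ('v \<times> 'a) strips_op" where
  "enc op = (strips_pstate V R (fst op), strips_pstate V R (snd op))"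

abbreviation \<Pi> :: "('v \<times> 'a) strips" where
  "\<Pi> \<equiv> strips_of (V, R, I, ops, G)"

lemma strips_eq:
  "\<Pi> = (Sigma V R, \<lambda>_. {False, True}, strips_pstate V R I, enc ` ops, strips_pstate V R G)"
  by (force simp: enc_def)

lemma enc_inv: "op \<in> ops \<Longrightarrow> strips_op_inv (enc op) = op"
  using pre eff by (simp add: enc_def strips_op_inv_strips_pstate del: strips_op_inv.simps)

lemma strips_finite: "strips_finite \<Pi>"
proof -
  have fin: "finite (Sigma V R)"
    using finite_V finite_R by blast
  have "finite (strips_pstate V R s)" "Domain (strips_pstate V R s) \<subseteq> Sigma V R"
    if "pstate V R s" for s
  proof -
    show "finite (strips_pstate V R s)"
      by (rule finite_subset[OF strips_pstate_subset[OF that] finite_cartesian_product[OF fin]]) simp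
    show "Domain (strips_pstate V R s) \<subseteq> Sigma V R"
      using strips_pstate_subset[OF that] by auto
  qed
  then show ?thesis
    unfolding strips_eq strips_finite.simps using fin init goal pre eff finite_ops
    by (simp add: enc_def del: split_paired_All)
qed

lemma holds_at_enc:
  assumes "op \<in> ops"
  shows "holds_at M t (fst (enc op)) \<longleftrightarrow>
      (\<forall>v \<in> Domain (fst op). \<forall>a \<in> R v. M (VarAt (v, a) t) \<longleftrightarrow> (v, a) \<in> fst op)"
    and "holds_at M t (snd (enc op)) \<longleftrightarrow>
      (\<forall>v \<in> Domain (snd op). \<forall>a \<in> R v. M (VarAt (v, a) t) \<longleftrightarrow> (v, a) \<in> snd op)"
  using pre[OF assms] eff[OF assms] by (simp_all only: enc_def fst_conv snd_conv holds_at_strips_pstate)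

lemma enc_iff:
  assumes "op \<in> ops"
  shows "((v, a), b) \<in> fst (enc op) \<longleftrightarrow> v \<in> Domain (fst op) \<and> a \<in> R v \<and> (b \<longleftrightarrow> (v, a) \<in> fst op)"
    and "((v, a), b) \<in> snd (enc op) \<longleftrightarrow> v \<in> Domain (snd op) \<and> a \<in> R v \<and> (b \<longleftrightarrow> (v, a) \<in> snd op)"
  using pre[OF assms] eff[OF assms] by (simp_all only: enc_def fst_conv snd_conv strips_pstate_iff)

text \<open>Quantifies over FDR operators and values instead of STRIPS ones. As \<open>I\<close> is
  total, the initial condition fixes every variable atom at time 0.\<close>

lemma strips_model_iff:
  "strips_model M \<Pi> h \<longleftrightarrow>
     (\<forall>v \<in> V. \<forall>a \<in> R v. M (VarAt (v, a) 0) \<longleftrightarrow> (v, a) \<in> I) \<and>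
     (\<forall>v \<in> Domain G. \<forall>a \<in> R v. M (VarAt (v, a) h) \<longleftrightarrow> (v, a) \<in> G) \<and>
     (\<forall>t < h. \<forall>op \<in> ops. M (OpAt (enc op) t) \<longrightarrow>
        holds_at M t (fst (enc op)) \<and> holds_at M (Suc t) (snd (enc op))) \<and>
     (\<forall>t < h. \<forall>v \<in> V. \<forall>a \<in> R v. \<not> M (VarAt (v, a) t) \<and> M (VarAt (v, a) (Suc t)) \<longrightarrow>
        (\<exists>op \<in> ops. ((v, a), True) \<in> snd (enc op) \<and> M (OpAt (enc op) t))) \<and>
     (\<forall>t < h. \<forall>v \<in> V. \<forall>a \<in> R v. M (VarAt (v, a) t) \<and> \<not> M (VarAt (v, a) (Suc t)) \<longrightarrow>
        (\<exists>op \<in> ops. ((v, a), False) \<in> snd (enc op) \<and> M (OpAt (enc op) t))) \<and>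
     (\<forall>t < h. \<forall>op \<in> ops. \<forall>op' \<in> ops. interfering (enc op) (enc op') \<longrightarrow>
        \<not> (M (OpAt (enc op) t) \<and> M (OpAt (enc op') t)))"
  by (simp only: strips_eq strips_model.simps holds_at_strips_pstate[OF init]
      holds_at_strips_pstate[OF goal] Domain_init ball_simps bex_simps split_paired_Ball_Sigma)

text \<open>Setting \<open>v\<close> to another value than \<open>a\<close> includes, in the STRIPS
  encoding, deleting the proposition \<open>(v, a)\<close>, which \<open>op\<close> requires. The
  contrapositive yields the compatibility condition of \<open>fdr_leads_to_parallel\<close>.\<close>

lemma interfering_enc:
  assumes "op \<in> ops" "op' \<in> ops" "op \<noteq> op'" "(v, a) \<in> fst op" "v \<in> Domain (snd op')"
    and "(v, a) \<notin> snd op'"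
  shows "interfering (enc op) (enc op')"
proof -
  have "a \<in> R v" "v \<in> Domain (fst op)"
    using pre[OF assms(1)] assms(4) by (auto simp: pstate_def)
  then have "((v, a), True) \<in> fst (enc op)" "((v, a), False) \<in> snd (enc op')"
    using assms by (simp_all add: enc_iff)
  \<comment> \<open>Interference requires distinct operators; \<open>enc\<close> is injective since
    it has a left inverse on \<open>ops\<close>.\<close>
  moreover have "enc op \<noteq> enc op'"
    using assms enc_inv by metis
  ultimately show ?thesis
    unfolding interfering_def by blast
qed

text \<open>One time step of the valuation is the parallel execution of all operators true at that
  time, in any order.\<close>

lemma strips_model_step:
  assumes M: "strips_model M \<Pi> h" and "t < h"
    and L: "distinct L" "set L = {op \<in> ops. M (OpAt (enc op) t)}"
  defines "s \<equiv> \<lambda>t. {(v, a) \<in> Sigma V R. M (VarAt (v, a) t)}"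
  shows "fdr_leads_to (s t) L (s (Suc t))"
proof -
  define E where "E = (\<Union>op \<in> set L. snd op)"
  have in_ops: "op \<in> ops" "M (OpAt (enc op) t)" if "op \<in> set L" for op
    using that L(2) by simp_all
  have "holds_at M t (fst (enc op))" and "holds_at M (Suc t) (snd (enc op))" if "op \<in> set L" for op
    using M in_ops[OF that] \<open>t < h\<close> by (simp_all only: strips_model_iff)
  then have preM: "\<lbrakk>op \<in> set L; v \<in> Domain (fst op); a \<in> R v\<rbrakk> \<Longrightarrow>
      M (VarAt (v, a) t) \<longleftrightarrow> (v, a) \<in> fst op"
    and effM: "\<lbrakk>op \<in> set L; v \<in> Domain (snd op); a \<in> R v\<rbrakk> \<Longrightarrow>
      M (VarAt (v, a) (Suc t)) \<longleftrightarrow> (v, a) \<in> snd op"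
    for op v a
    using in_ops(1) holds_at_enc by blast+
  have R_pre: "v \<in> V \<and> a \<in> R v" if "op \<in> set L" "(v, a) \<in> fst op" for op v a
    using that(2) pre[OF in_ops(1)[OF that(1)]] by (auto simp: pstate_def)
  have R_eff: "v \<in> V \<and> a \<in> R v" if "op \<in> set L" "(v, a) \<in> snd op" for op v a
    using that(2) eff[OF in_ops(1)[OF that(1)]] by (auto simp: pstate_def)
  \<comment> \<open>An effect fixes the next truth value for every value of each variable it
    touches, so on touched variables \<open>E\<close> coincides with the next state.\<close>
  have E_iff: "(v, a) \<in> E \<longleftrightarrow> M (VarAt (v, a) (Suc t))" if "v \<in> Domain E" "a \<in> R v" for v a
  proof -
    obtain op where "op \<in> set L" "v \<in> Domain (snd op)"
      using \<open>v \<in> Domain E\<close> unfolding E_def by blast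
    then have "M (VarAt (v, a) (Suc t)) \<Longrightarrow> (v, a) \<in> E"
      using effM \<open>a \<in> R v\<close> unfolding E_def by blast
    moreover have "(v, a) \<in> E \<Longrightarrow> M (VarAt (v, a) (Suc t))"
      using effM \<open>a \<in> R v\<close> unfolding E_def by blast
    ultimately show ?thesis by blast
  qed
  have "E \<subseteq> Sigma V R"
    using R_eff unfolding E_def by auto
  \<comment> \<open>A second maplet for \<open>v\<close>, being true at the next time point, already
    belongs to the effect that contributes the first one, and that effect is single-valued.\<close>
  have "single_valued E"
  proof (rule single_valuedI)
    fix v a b assume a: "(v, a) \<in> E" and b: "(v, b) \<in> E"
    from a obtain op where op: "op \<in> set L" "(v, a) \<in> snd op"
      unfolding E_def by blast
    have "v \<in> Domain E" "b \<in> R v" using b \<open>E \<subseteq> Sigma V R\<close> by auto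
    then have "(v, b) \<in> snd op"
      using b E_iff effM[OF op(1)] op(2) by blast
    then show "a = b"
      using op eff[OF in_ops(1)[OF op(1)]] unfolding pstate_def single_valued_def by blast
  qed
  have "fst op \<subseteq> s t" if "op \<in> set L" for op
    using preM[OF that] R_pre[OF that] unfolding s_def by blast
  moreover have "(v, a) \<in> snd op'"
    if "op \<in> set L" "op' \<in> set L" "op \<noteq> op'" "(v, a) \<in> fst op" "v \<in> Domain (snd op')" for op op' v a
  proof (rule ccontr)
    assume "(v, a) \<notin> snd op'"
    then have "interfering (enc op) (enc op')"
      using that in_ops(1) by (intro interfering_enc)
    then show False
      using M in_ops[OF that(1)] in_ops[OF that(2)] \<open>t < h\<close> unfolding strips_model_iff by blast
  qed
  ultimately have "fdr_leads_to (s t) L (override (s t) E)"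
    using L(1) \<open>single_valued E\<close> unfolding E_def by (intro fdr_leads_to_parallel)
  moreover have "override (s t) E = s (Suc t)"
  proof -
    have "(v, a) \<in> override (s t) E \<longleftrightarrow> M (VarAt (v, a) (Suc t))" if va: "v \<in> V" "a \<in> R v" for v a
    proof (cases "v \<in> Domain E")
      case True
      then show ?thesis using E_iff va by (auto simp: override_def)
    next
      case False
      \<comment> \<open>A change of \<open>(v, a)\<close> would need, by the frame conditions, a
        true operator whose effect mentions \<open>v\<close>; but all true operators are in
        \<open>L\<close>, and \<open>v\<close> is outside the domain of \<open>E\<close>.\<close>
      have "((v, a), b) \<notin> snd (enc op)" if "op \<in> ops" "M (OpAt (enc op) t)" for op b
        using that False L(2) unfolding enc_iff[OF that(1)] E_def by blast
      then have "M (VarAt (v, a) t) \<longleftrightarrow> M (VarAt (v, a) (Suc t))"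
        using M \<open>t < h\<close> va unfolding strips_model_iff by blast
      then show ?thesis using False va by (auto simp: override_def s_def)
    qed
    moreover have "override (s t) E \<subseteq> Sigma V R" "s (Suc t) \<subseteq> Sigma V R"
      using \<open>E \<subseteq> Sigma V R\<close> by (auto simp: override_def s_def)
    ultimately show ?thesis by (auto simp: s_def)
  qed
  ultimately show ?thesis by simp
qed

lemma strips_model_sound:
  assumes M: "strips_model M \<Pi> h"
    and L: "\<And>t. t < h \<Longrightarrow> distinct (L t) \<and> set (L t) = {op \<in> ops. M (OpAt (enc op) t)}"
  shows "\<exists>s. fdr_leads_to I (concat (map L [0..<h])) s \<and> G \<subseteq> s"
proof -
  define s where "s t = {(v, a) \<in> Sigma V R. M (VarAt (v, a) t)}" for t
  have "\<forall>v \<in> V. \<forall>a \<in> R v. M (VarAt (v, a) 0) \<longleftrightarrow> (v, a) \<in> I"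
    using M unfolding strips_model_iff by (elim conjE)
  then have s0: "s 0 = I"
    using init unfolding s_def pstate_def by blast
  have "fdr_leads_to I (concat (map L [0..<t])) (s t)" if "t \<le> h" for t
    using that
  proof (induction t)
    case 0
    then show ?case by (simp add: s0)
  next
    case (Suc t)
    then have t: "t < h" and "fdr_leads_to I (concat (map L [0..<t])) (s t)"
      by simp_all
    moreover have "fdr_leads_to (s t) (L t) (s (Suc t))"
      unfolding s_def using L[OF t] by (intro strips_model_step[OF M t]) simp_all
    ultimately show ?case
      by (simp add: fdr_leads_to_append)
  qed
  moreover have "\<forall>v \<in> Domain G. \<forall>a \<in> R v. M (VarAt (v, a) h) \<longleftrightarrow> (v, a) \<in> G"
    using M unfolding strips_model_iff by (elim conjE)
  then have "G \<subseteq> s h"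
    using goal unfolding s_def pstate_def by blast
  ultimately show ?thesis by blast
qed

text \<open>The valuation follows the execution with exactly one operator per time step, so the
  horizon is the length of the sequence and interference cannot arise.\<close>

lemma strips_model_complete:
  assumes "fdr_leads_to I \<pi> s'" and "G \<subseteq> s'" and "set \<pi> \<subseteq> ops"
  shows "\<exists>M. strips_model M \<Pi> (length \<pi>)"
proof -
  \<comment> \<open>The state after the first \<open>t\<close> operators, as an explicit function,
    since \<open>fdr_leads_to\<close> does not expose intermediate states.\<close>
  define s where "s t = foldl (\<lambda>s op. override s (snd op)) I (take t \<pi>)" for t
  let ?h = "length \<pi>"
  have op: "\<pi> ! t \<in> ops" if "t < ?h" for t
    using assms(3) that by auto
  have s0: "s 0 = I" by (simp add: s_def)
  have s_Suc: "s (Suc t) = override (s t) (snd (\<pi> ! t))" if "t < ?h" for t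
    using that by (simp add: s_def take_Suc_conv_app_nth)
  \<comment> \<open>Generalised over the start state for the induction; extracts from the execution
    that all preconditions hold along \<open>s\<close>.\<close>
  have "(\<forall>t < length \<rho>. fst (\<rho> ! t) \<subseteq> foldl (\<lambda>s op. override s (snd op)) r (take t \<rho>)) \<and>
      s' = foldl (\<lambda>s op. override s (snd op)) r \<rho>" if "fdr_leads_to r \<rho> s'" for r \<rho>
    using that by (induction \<rho> arbitrary: r) (auto simp: nth_Cons' take_Cons')
  from this[OF assms(1)] have pre_s: "\<forall>t < ?h. fst (\<pi> ! t) \<subseteq> s t" and "s' = s ?h"
    by (auto simp: s_def)
  then have goal_s: "G \<subseteq> s ?h" using assms(2) by simp
  have s: "pstate V R (s t)" if "t \<le> ?h" for t
    using that
  proof (induction t)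
    case 0
    then show ?case using init by (simp add: s0)
  next
    case (Suc t)
    then have "pstate V R (s t)" "pstate V R (snd (\<pi> ! t))" "s (Suc t) = override (s t) (snd (\<pi> ! t))"
      using eff[OF op] s_Suc by auto
    then show ?case
      unfolding pstate_def using single_valued_override by (auto simp: override_def)
  qed
  \<comment> \<open>From \<open>t = length \<pi>\<close> on, the operator atoms depend on the
    unspecified \<open>\<pi> ! t\<close>, but the conditions only look at operator atoms before the
    horizon.\<close>
  define M where "M a = (case a of VarAt va t \<Rightarrow> va \<in> s t | OpAt op t \<Rightarrow> op = enc (\<pi> ! t))" for a
  have M: "M (VarAt va t) \<longleftrightarrow> va \<in> s t" "M (OpAt op t) \<longleftrightarrow> op = enc (\<pi> ! t)" for va op t
    by (simp_all add: M_def)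
  have agree: "(v, a) \<in> s t \<longleftrightarrow> (v, a) \<in> r" if "r \<subseteq> s t" "t \<le> ?h" "v \<in> Domain r" for r t v a
    using that(1,3) s[OF that(2)] unfolding pstate_def single_valued_def by blast
  have step: "holds_at M t (fst (enc (\<pi> ! t))) \<and> holds_at M (Suc t) (snd (enc (\<pi> ! t)))"
    if "t < ?h" for t
  proof -
    have "fst (\<pi> ! t) \<subseteq> s t" "snd (\<pi> ! t) \<subseteq> s (Suc t)"
      using pre_s s_Suc that by (auto simp: override_def)
    then show ?thesis
      unfolding holds_at_enc[OF op[OF that]] M using agree that by (meson Suc_leI less_imp_le)
  qed
  \<comment> \<open>Overriding copies untouched variables, so any change stems from the effect. The
    truth value \<open>b\<close> covers both kinds of frame conditions.\<close>
  have change: "\<exists>op \<in> ops. ((v, a), b) \<in> snd (enc op) \<and> enc op = enc (\<pi> ! t)"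
    if "t < ?h" "v \<in> V" "a \<in> R v" "(v, a) \<in> s t \<longleftrightarrow> \<not> b" "(v, a) \<in> s (Suc t) \<longleftrightarrow> b" for t v a b
  proof -
    have "((v, a), b) \<in> snd (enc (\<pi> ! t))"
      unfolding enc_iff[OF op[OF that(1)]] using that(3-5) s_Suc[OF that(1)]
      by (auto simp: override_def)
    then show ?thesis using op[OF that(1)] by blast
  qed
  have "strips_model M \<Pi> ?h"
    unfolding strips_model_iff
  proof (intro conjI)
    show "\<forall>v \<in> Domain G. \<forall>a \<in> R v. M (VarAt (v, a) ?h) \<longleftrightarrow> (v, a) \<in> G"
      using agree[OF goal_s] by (simp add: M)
    show "\<forall>t < ?h. \<forall>op \<in> ops. M (OpAt (enc op) t) \<longrightarrow>
        holds_at M t (fst (enc op)) \<and> holds_at M (Suc t) (snd (enc op))"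
      using step unfolding M by metis
    show "\<forall>t < ?h. \<forall>op \<in> ops. \<forall>op' \<in> ops. interfering (enc op) (enc op') \<longrightarrow>
        \<not> (M (OpAt (enc op) t) \<and> M (OpAt (enc op') t))"
      \<comment> \<open>Two operators true at \<open>t\<close> both equal
        \<open>enc (\<pi> ! t)\<close>, while interfering ones are distinct.\<close>
      unfolding M by (auto simp: interfering_def)
    show "\<forall>t < ?h. \<forall>v \<in> V. \<forall>a \<in> R v. \<not> M (VarAt (v, a) t) \<and> M (VarAt (v, a) (Suc t)) \<longrightarrow>
        (\<exists>op \<in> ops. ((v, a), True) \<in> snd (enc op) \<and> M (OpAt (enc op) t))"
      unfolding M using change[where b = True] by blast
    show "\<forall>t < ?h. \<forall>v \<in> V. \<forall>a \<in> R v. M (VarAt (v, a) t) \<and> \<not> M (VarAt (v, a) (Suc t)) \<longrightarrow>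
        (\<exists>op \<in> ops. ((v, a), False) \<in> snd (enc op) \<and> M (OpAt (enc op) t))"
      unfolding M using change[where b = False] by blast
  qed (simp add: M s0)
  then show ?thesis by (rule exI[of _ M])
qed

end


section \<open>FD-AST problems\<close>

lemma pstate_of_wf_pstate:
  assumes "mapping s" and "wf_pstate V s"
  shows "pstate (Domain V) (\<lambda>v. {0..<val V v}) s"
proof -
  have sv: "single_valued s" using assms(1) by (simp add: mapping_def)
  have "v \<in> Domain V \<and> a < val V v" if "(v, a) \<in> s" for v a
  proof -
    have "v \<in> Domain s" "val s v = a" using that val_eq_iff[OF sv, of v a] by blast+
    then show ?thesis using assms(2) by (auto simp: wf_pstate_def)
  qed
  then show ?thesis using sv by (auto simp: pstate_def)
qed

section \<open>A fixed valid FD-AST problem and its FDR encoding\<close>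

locale valid_ast =
  fixes V I G :: nmap and ops :: "ast_op set"
  assumes ast: "fd_ast (V, I, G, ops)" and valid: "valid_problem (V, I, G, ops)"
begin

abbreviation R :: "nat \<Rightarrow> nat set" where
  "R \<equiv> \<lambda>v. {0..<val V v}"

text \<open>The last two facts make the FDR effect and precondition single-valued: distinct effects
  have distinct variables, and prevail conditions agree with the old values
  \<open>l\<close>.\<close>

lemma op_facts:
  assumes "(name, ps, es) \<in> ops"
  shows "mapping ps" "wf_pstate V ps"
    and "(epre, v, l, m) \<in> es \<Longrightarrow> epre = {} \<and> v \<in> Domain V \<and> l < val V v \<and> m < val V v"
    and "(epre, v, l, m) \<in> es \<Longrightarrow> (epre', v, l', m') \<in> es \<Longrightarrow> l = l' \<and> m = m'"
    and "(epre, v, l, m) \<in> es \<Longrightarrow> (v, a) \<in> ps \<Longrightarrow> a = l"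
proof -
  show "mapping ps" using ast assms by auto
  have wf: "wf_op V (name, ps, es)"
    using valid assms unfolding valid_problem.simps wf_problem.simps by blast
  then show "wf_pstate V ps" by simp
  have "\<forall>(name, ps, es) \<in> ops. \<forall>(epre, v, l, m) \<in> es. epre = {} \<and> (v \<in> Domain ps \<longrightarrow> val ps v = l)"
    using valid by simp
  from bspec[OF this assms]
  have v: "\<forall>(epre, v, l, m) \<in> es. epre = {} \<and> (v \<in> Domain ps \<longrightarrow> val ps v = l)"
    by simp
  show "epre = {} \<and> v \<in> Domain V \<and> l < val V v \<and> m < val V v" if "(epre, v, l, m) \<in> es"
    using wf v that by fastforce
  show "l = l' \<and> m = m'" if "(epre, v, l, m) \<in> es" "(epre', v, l', m') \<in> es"
    using wf that by fastforce
  show "a = l" if "(epre, v, l, m) \<in> es" "(v, a) \<in> ps"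
  proof -
    have "v \<in> Domain ps" using that(2) by blast
    then have "val ps v = l" "val ps v = a"
      using bspec[OF v that(1)] that(2) \<open>mapping ps\<close> val_eq_iff[of ps v a]
      by (simp_all add: mapping_def)
    then show ?thesis by simp
  qed
qed

lemma fdr_op_of_pstate:
  assumes "op \<in> ops"
  shows "pstate (Domain V) R (fst (fdr_op_of op))" and "pstate (Domain V) R (snd (fdr_op_of op))"
proof -
  obtain name ps es where op: "op = (name, ps, es)" by (metis prod_cases3)
  note facts = op_facts[OF assms[unfolded op]]
  have ps: "single_valued ps" "ps \<subseteq> Sigma (Domain V) R"
    using pstate_of_wf_pstate[OF facts(1,2)] by (auto simp: pstate_def)
  show "pstate (Domain V) R (fst (fdr_op_of op))"
    unfolding op pstate_def fdr_op_of.simps fst_conv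
  proof
    show "single_valued (ps \<union> {(v, l) |epre v l m. (epre, v, l, m) \<in> es})"
      using ps(1) facts(4,5) unfolding single_valued_def by blast
    show "ps \<union> {(v, l) |epre v l m. (epre, v, l, m) \<in> es} \<subseteq> Sigma (Domain V) R"
      using ps(2) facts(3) by fastforce
  qed
  show "pstate (Domain V) R (snd (fdr_op_of op))"
    unfolding op pstate_def fdr_op_of.simps snd_conv
  proof
    show "single_valued {(v, m) |epre v l m. (epre, v, l, m) \<in> es}"
      using facts(4) unfolding single_valued_def by blast
    show "{(v, m) |epre v l m. (epre, v, l, m) \<in> es} \<subseteq> Sigma (Domain V) R"
      using facts(3) by fastforce
  qed
qed

lemma executable_iff: "executable op s \<longleftrightarrow> fst (fdr_op_of op) \<subseteq> s"
proof -
  obtain name ps es where op: "op = (name, ps, es)" by (metis prod_cases3)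
  show ?thesis
    unfolding op executable.simps fdr_op_of.simps fst_conv by blast
qed

text \<open>The overwritten variables have the value \<open>l\<close> in \<open>s\<close>, hence deleting these maplets amounts to
  deleting the variables.\<close>

lemma result_eq:
  assumes "op \<in> ops" and "single_valued s" and "executable op s"
  shows "result op s = override s (snd (fdr_op_of op))"
proof -
  obtain name ps es where op: "op = (name, ps, es)" by (metis prod_cases3)
  \<comment> \<open>Validity makes all effects unconditional, which removes the test
    \<open>epre \<subseteq> s\<close>.\<close>
  have epre: "epre = {}" if "(epre, v, l, m) \<in> es" for epre v l m
    using op_facts(3)[OF assms(1)[unfolded op] that] by simp
  let ?L = "{(v, l) | epre v l m. (epre, v, l, m) \<in> es}"
  let ?E = "{(v, m) | epre v l m. (epre, v, l, m) \<in> es}"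
  have "{(v, l) | epre v l m. (epre, v, l, m) \<in> es \<and> epre \<subseteq> s} = ?L"
    and "{(v, m) | epre v l m. (epre, v, l, m) \<in> es \<and> epre \<subseteq> s} = ?E"
    using epre by blast+
  then have "result op s = (s - ?L) \<union> ?E"
    by (simp only: op result.simps)
  moreover have "?L \<subseteq> s"
    using assms(3) unfolding op executable.simps by blast
  moreover have "Domain ?L = Domain ?E" by blast
  ultimately have "result op s = override s ?E"
    by (simp only: Diff_Un_eq_override[OF assms(2)])
  then show ?thesis
    by (simp only: op fdr_op_of.simps snd_conv)
qed

text \<open>The induction carries along single-valuedness of the state, which
  \<open>result_eq\<close> demands and which overriding by a single-valued effect preserves.\<close>

lemma leads_to_iff:
  assumes "set \<pi> \<subseteq> ops" and "single_valued s"
  shows "leads_to s \<pi> s' \<longleftrightarrow> fdr_leads_to s (map fdr_op_of \<pi>) s'"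
  using assms
proof (induction \<pi> arbitrary: s)
  case (Cons op \<pi>)
  show ?case
  proof (cases "executable op s")
    case True
    have "single_valued (result op s)"
      using Cons.prems True fdr_op_of_pstate(2)[of op]
      by (auto simp: result_eq pstate_def intro!: single_valued_override)
    then show ?thesis
      using Cons True by (simp add: result_eq executable_iff[symmetric])
  qed (simp add: executable_iff[symmetric])
qed simp

sublocale fdr: fdr_problem "Domain V" R I "fdr_op_of ` ops" G
proof
  show "finite (Domain V)" "finite (fdr_op_of ` ops)"
    using ast by (auto simp: mapping_def finite_Domain)
  show "pstate (Domain V) R I" "pstate (Domain V) R G" "Domain I = Domain V"
    using ast valid pstate_of_wf_pstate by (auto simp: wf_state_def)
qed (use fdr_op_of_pstate in auto)

lemma is_plan_iff:
  "is_plan (V, I, G, ops) names \<longleftrightarrow> (\<exists>\<pi> s. set \<pi> \<subseteq> ops \<and> map op_name \<pi> = names \<and>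
     fdr_leads_to I (map fdr_op_of \<pi>) s \<and> G \<subseteq> s)"
proof -
  have "single_valued I" using fdr.init by (simp add: pstate_def)
  then show ?thesis using leads_to_iff[of _ I] by (simp cong: conj_cong)
qed

text \<open>Several operators may share an FDR encoding. Whichever name \<open>ch\<close> picks, it
  belongs to an operator encoded as \<open>fop\<close>, and execution depends only on the
  encoding.\<close>

lemma ast_of_fdr_op:
  assumes "choice_fun ch" and "fop \<in> fdr_op_of ` ops"
  shows "\<exists>op \<in> ops. fdr_op_of op = fop \<and> op_name op = ast_of ch (V, I, G, ops) fop"
proof -
  let ?S = "{name. \<exists>ps es. (name, ps, es) \<in> ops \<and> fdr_op_of (name, ps, es) = fop}"
  have "?S \<noteq> {}" using assms(2) by (auto simp del: fdr_op_of.simps)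
  moreover have "?S \<noteq> {} \<longrightarrow> ch ?S \<in> ?S"
    using assms(1) unfolding choice_fun_def by (rule spec)
  ultimately have "ch ?S \<in> ?S" by (rule rev_mp)
  then obtain ps es where "(ch ?S, ps, es) \<in> ops" "fdr_op_of (ch ?S, ps, es) = fop"
    unfolding mem_Collect_eq by (elim exE conjE)
  then show ?thesis
    by (intro bexI[of _ "(ch ?S, ps, es)"]) (simp_all only: op_name.simps ast_of.simps simp_thms)
qed

end

theorem theorem5:
  fixes P :: ast_problem
    and h :: nat
    and \<Pi> :: "(nat \<times> nat) strips"
    and ch :: "string set \<Rightarrow> string"
    and lv :: "(nat \<times> nat) set \<Rightarrow> (nat \<times> nat) list"
    and lo :: "(nat \<times> nat) strips_op set \<Rightarrow> (nat \<times> nat) strips_op list"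
    and lp :: "((nat \<times> nat) strips_op \<times> (nat \<times> nat) strips_op) set
                 \<Rightarrow> ((nat \<times> nat) strips_op \<times> (nat \<times> nat) strips_op) list"
    and lt :: "nat \<Rightarrow> (nat \<times> nat) strips_op set \<Rightarrow> (nat \<times> nat) strips_op list"
    and iv :: "nat \<times> nat \<Rightarrow> nat"
    and io :: "(nat \<times> nat) strips_op \<Rightarrow> nat"
  defines "\<Pi> \<equiv> strips_of (fdr_of P)"
  assumes "fd_ast P" and "valid_problem P"
    and "choice_fun ch"
    and "listing_fun lv" and "listing_fun lo" and "listing_fun lp"
    and "\<And>t. listing_fun (lt t)"
    and "indexing iv (vars_of \<Pi>)" and "indexing io (ops_of \<Pi>)"
  shows "(\<forall>ns :: int list.
            dimacs_model ns (simp_cnf (atom_int iv io \<Pi> h) (sat_encoding lv lo lp \<Pi> h)) \<longrightarrow>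
            is_plan P (map (\<lambda>op. ast_of ch P (strips_op_inv op))
                           (sat_decoding lt \<Pi> h (lits iv io \<Pi> h ns))))
       \<and> (\<forall>names. length names = h \<and> is_plan P names \<longrightarrow>
            (\<exists>ns :: int list.
               dimacs_model ns (simp_cnf (atom_int iv io \<Pi> h) (sat_encoding lv lo lp \<Pi> h))))"
proof -
  obtain V I G ops where P: "P = (V, I, G, ops)" by (metis prod_cases4)
  interpret valid_ast V I G ops
    using assms(2,3) by unfold_locales (simp_all only: P)
  have \<Pi>: "\<Pi> = fdr.\<Pi>"
    by (simp only: assms(1) P fdr_of.simps)
  have sfin: "strips_finite \<Pi>"
    unfolding \<Pi> by (rule fdr.strips_finite)
  let ?f = "atom_int iv io \<Pi> h"
  define F where "F = fdr_op_of ` ops"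
  have ops_of: "ops_of \<Pi> = fdr.enc ` F"
    by (simp only: \<Pi> fdr.strips_eq ops_of.simps F_def)
  have inv: "strips_op_inv (fdr.enc fop) = fop" if "fop \<in> F" for fop
    using that unfolding F_def by (rule fdr.enc_inv)
  note sat_iff = sat_encoding_iff[OF assms(5-7) sfin]
  show ?thesis
  proof (intro conjI allI impI)

    \<comment> \<open>From a DIMACS model to a plan\<close>
    fix ns
    assume model: "dimacs_model ns (simp_cnf ?f (sat_encoding lv lo lp \<Pi> h))"
    define M where "M a \<longleftrightarrow> ?f a \<in> set ns" for a
    have M: "strips_model M \<Pi> h"
      using sat_of_dimacs_model[OF cnf_sat_encoding model] by (simp add: sat_iff M_def[abs_def])
    define A where "A t = {op \<in> ops_of \<Pi>. M (OpAt op t)}" for t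
    have finA: "finite (A t)" for t
      using fdr.finite_ops by (simp add: A_def ops_of F_def)
    \<comment> \<open>Injectivity keeps the listings free of duplicates when they are translated
      back to FDR operators.\<close>
    have inj: "inj_on strips_op_inv (ops_of \<Pi>)"
      unfolding ops_of by (rule inj_on_inverseI[of _ fdr.enc]) (erule imageE, simp only: inv)
    \<comment> \<open>The decoding selects the same operators as the valuation \<open>M\<close>;
      \<open>t < h\<close> ensures that their atoms are numbered.\<close>
    have dec: "sat_decoding lt \<Pi> h (lits iv io \<Pi> h ns) = concat (map (\<lambda>t. lt t (A t)) [0..<h])"
    proof -
      have "{op \<in> ops_of \<Pi>. Pos (OpAt op t) \<in> lits iv io \<Pi> h ns} = A t" if "t < h" for t
        using Pos_in_lits_iff[OF assms(9,10), of "OpAt _ t" h ns] that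
        by (auto simp: A_def M_def OpAt_in_atoms simp del: atom_int.simps)
      then show ?thesis
        unfolding \<Pi> fdr.strips_eq
        by (auto intro!: arg_cong[where f = concat] map_cong)
    qed
    have "distinct (map strips_op_inv (lt t (A t))) \<and>
        set (map strips_op_inv (lt t (A t))) = {op \<in> F. M (OpAt (fdr.enc op) t)}" for t
    proof
      show "distinct (map strips_op_inv (lt t (A t)))"
        using distinct_listing[OF assms(8) finA] set_listing[OF assms(8) finA]
          inj_on_subset[OF inj, of "A t"]
        by (auto simp: distinct_map A_def)
      show "set (map strips_op_inv (lt t (A t))) = {op \<in> F. M (OpAt (fdr.enc op) t)}"
      proof -
        have "A t = fdr.enc ` {op \<in> F. M (OpAt (fdr.enc op) t)}"
          unfolding A_def ops_of by blast
        then have "strips_op_inv ` A t = {op \<in> F. M (OpAt (fdr.enc op) t)}"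
          by (simp add: image_image inv cong: image_cong_simp del: split_paired_Ex)
        then show ?thesis
          unfolding set_map set_listing[OF assms(8) finA] .
      qed
    qed
    then obtain s where s: "fdr_leads_to I (concat (map (\<lambda>t. map strips_op_inv (lt t (A t))) [0..<h])) s"
      "G \<subseteq> s"
      using fdr.strips_model_sound[OF M[unfolded \<Pi>], of "\<lambda>t. map strips_op_inv (lt t (A t))"]
      unfolding F_def by blast
    define L where "L = map strips_op_inv (sat_decoding lt \<Pi> h (lits iv io \<Pi> h ns))"
    have lead: "fdr_leads_to I L s"
      using s(1) by (simp add: L_def dec map_concat comp_def)
    have "set L \<subseteq> strips_op_inv ` ops_of \<Pi>"
    proof -
      have "set (concat (map (\<lambda>t. lt t (A t)) [0..<h])) \<subseteq> ops_of \<Pi>"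
        by (auto simp: set_listing[OF assms(8) finA]) (simp_all add: A_def)
      then show ?thesis unfolding L_def dec set_map by (rule image_mono)
    qed
    also have "\<dots> = F"
      by (simp add: ops_of image_image inv cong: image_cong_simp)
    finally have "set L \<subseteq> F" .
    \<comment> \<open>\<open>g\<close> picks an FD-AST operator that bears the decoded name and has
      the given FDR encoding; mapping it over \<open>L\<close> gives the operator sequence
      witnessing the plan.\<close>
    moreover obtain g where g: "\<And>fop. fop \<in> F \<Longrightarrow>
        g fop \<in> ops \<and> fdr_op_of (g fop) = fop \<and> op_name (g fop) = ast_of ch P fop"
      using ast_of_fdr_op[OF assms(4)] unfolding P F_def by metis
    ultimately have "set (map g L) \<subseteq> ops" "map fdr_op_of (map g L) = L"
      "map op_name (map g L) = map (ast_of ch P) L"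
      by (auto simp: subset_iff intro!: map_idI)
    then have "is_plan P (map (ast_of ch P) L)"
      using lead s(2) unfolding P is_plan_iff by metis
    then show "is_plan P (map (\<lambda>op. ast_of ch P (strips_op_inv op))
        (sat_decoding lt \<Pi> h (lits iv io \<Pi> h ns)))"
      by (simp add: L_def comp_def)
  next

    \<comment> \<open>From a plan to a DIMACS model\<close>
    fix names
    assume "length names = h \<and> is_plan P names"
    then obtain \<pi> s where \<pi>: "set \<pi> \<subseteq> ops" "length \<pi> = h"
        "fdr_leads_to I (map fdr_op_of \<pi>) s" "G \<subseteq> s"
      unfolding P is_plan_iff by fastforce
    have "set (map fdr_op_of \<pi>) \<subseteq> fdr_op_of ` ops"
      unfolding set_map using \<pi>(1) by (rule image_mono)
    then obtain M where "strips_model M \<Pi> h"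
      using fdr.strips_model_complete[OF \<pi>(3,4)] unfolding \<Pi> length_map \<pi>(2) by blast
    then have "sat M (sat_encoding lv lo lp \<Pi> h)"
      by (simp add: sat_iff)
    \<comment> \<open>The numbering is a bijection onto an integer interval starting at 1, hence
      finiteness, injectivity and positivity.\<close>
    moreover have "finite (atoms \<Pi> h)" "inj_on ?f (atoms \<Pi> h)"
      using atom_int_bij[OF assms(9,10), of h] bij_betw_finite bij_betw_imp_inj_on by blast+
    moreover have "?f a > 0" if "a \<in> atoms \<Pi> h" for a
      using bij_betwE[OF atom_int_bij[OF assms(9,10), of h]] that
      by (metis atLeastAtMost_iff zero_less_one less_le_trans)
    ultimately show "\<exists>ns. dimacs_model ns (simp_cnf ?f (sat_encoding lv lo lp \<Pi> h))"
      using dimacs_model_of_sat[OF cnf_sat_encoding _ set_sat_encoding[OF assms(5-7) sfin]] by blast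
  qed
qed

end
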